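(* For every infinitely-ended group $G$, the space of ends $\mathcal{E}^\star(G)$ has no isolated point. In particular, if $\mathcal{E}^\star(G)$ is metrizable, it is homeomorphic to a Cantor space.
   Context: A subset $A$ of a group $G$ is left $G$-commensurated if $gA\bigtriangleup A$ is finite for every $g\in G$. These subsets form a Boolean subalgebra $\mathcal{P}_{(G)}(G)$ of the power set of $G$; $\mathcal{P}^\star_G(G)$ denotes its quotient by the ideal of finite subsets of $G$. The space of ends $\mathcal{E}^\star(G)$ is the Stone dual of $\mathcal{P}^\star_G(G)$, i.e. the compact Hausdorff totally disconnected space whose Boolean algebra of clopen subsets is $\mathcal{P}^\star_G(G)$. $G$ is infinitely-ended if $\mathcal{P}^\star_G(G)$ is infinite (equivalently, $\mathcal{E}^\star(G)$ is infinite). No countability assumption is made on $G$. *)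

theory Defs
  imports "HOL-Analysis.Analysis" "HOL-Algebra.Coset" "HOL-Algebra.Order"
begin

definition left_commensurated :: "('a, 'b) monoid_scheme \<Rightarrow> 'a set \<Rightarrow> bool" where
  "left_commensurated G A \<longleftrightarrow>
     A \<subseteq> carrier G \<and> (\<forall>g\<in>carrier G. finite (sym_diff (g <#\<^bsub>G\<^esub> A) A))"

definition almost_equal_rel :: "('a, 'b) monoid_scheme \<Rightarrow> ('a set \<times> 'a set) set" where
  "almost_equal_rel G =
     {(A, B). left_commensurated G A \<and> left_commensurated G B \<and> finite (sym_diff A B)}"

(* The quotient of the Boolean algebra of left commensurated subsets by the ideal of finite
   subsets, given by its order, which determines all the Boolean operations: one class lies
   below another iff some representative of the first is contained in some representative of the second. *)
definition end_algebra :: "('a, 'b) monoid_scheme \<Rightarrow> 'a set set gorder" where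
  "end_algebra G =
     \<lparr>carrier = Collect (left_commensurated G) // almost_equal_rel G,
      eq = (=),
      le = (\<lambda>X Y. \<exists>A\<in>X. \<exists>B\<in>Y. A \<subseteq> B)\<rparr>"

definition order_filter :: "('c, 'd) gorder_scheme \<Rightarrow> 'c set \<Rightarrow> bool" where
  "order_filter L F \<longleftrightarrow>
     F \<subseteq> carrier L \<and> F \<noteq> {} \<and>
     (\<forall>x\<in>F. \<forall>y\<in>carrier L. x \<sqsubseteq>\<^bsub>L\<^esub> y \<longrightarrow> y \<in> F) \<and>
     (\<forall>x\<in>F. \<forall>y\<in>F. \<exists>z\<in>F. z \<sqsubseteq>\<^bsub>L\<^esub> x \<and> z \<sqsubseteq>\<^bsub>L\<^esub> y)"

definition order_ultrafilter :: "('c, 'd) gorder_scheme \<Rightarrow> 'c set \<Rightarrow> bool" where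
  "order_ultrafilter L U \<longleftrightarrow>
     order_filter L U \<and> U \<noteq> carrier L \<and>
     (\<forall>F. order_filter L F \<and> F \<noteq> carrier L \<and> U \<subseteq> F \<longrightarrow> F = U)"

(* The Stone space of a Boolean algebra given by its order. *)
definition stone_dual :: "('c, 'd) gorder_scheme \<Rightarrow> 'c set topology" where
  "stone_dual L = topology_generated_by {{U. order_ultrafilter L U \<and> a \<in> U} | a. a \<in> carrier L}"

lemma topspace_stone_dual: "topspace (stone_dual L) = Collect (order_ultrafilter L)"
proof (rule Set.set_eqI)
  fix U
  have "\<exists>a. a \<in> carrier L \<and> a \<in> U" if "order_ultrafilter L U"
  proof -
    have "order_filter L U" using that by (simp add: order_ultrafilter_def)
    then have "U \<subseteq> carrier L" "U \<noteq> {}" by (simp_all add: order_filter_def)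
    then show ?thesis by auto
  qed
  moreover have "topspace (stone_dual L) =
      (\<Union>a\<in>carrier L. {U. order_ultrafilter L U \<and> a \<in> U})"
    by (simp only: stone_dual_def topology_generated_by_topspace Setcompr_eq_image)
  ultimately show "U \<in> topspace (stone_dual L) \<longleftrightarrow> U \<in> Collect (order_ultrafilter L)"
    by (simp only: UN_iff mem_Collect_eq) blast
qed

definition ends_space :: "('a, 'b) monoid_scheme \<Rightarrow> 'a set set set topology" where
  "ends_space G = stone_dual (end_algebra G)"

definition infinitely_ended :: "('a, 'b) monoid_scheme \<Rightarrow> bool" where
  "infinitely_ended G \<longleftrightarrow> infinite (carrier (end_algebra G))"

definition isolated_point_of :: "'c topology \<Rightarrow> 'c \<Rightarrow> bool" where
  "isolated_point_of X x \<longleftrightarrow> x \<in> topspace X \<and> openin X {x}"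

definition cantor_space :: "(nat \<Rightarrow> bool) topology" where
  "cantor_space = product_topology (\<lambda>_. discrete_topology UNIV) UNIV"

lemma left_commensurated_Int:
  assumes "group G" "left_commensurated G A" "left_commensurated G B"
  shows "left_commensurated G (A \<inter> B)"
  unfolding left_commensurated_def
proof (intro conjI ballI)
  show "A \<inter> B \<subseteq> carrier G" using assms by (auto simp: left_commensurated_def)
next
  fix g assume g: "g \<in> carrier G"
  interpret group G by fact
  have AB: "A \<subseteq> carrier G" "B \<subseteq> carrier G"
    using assms by (auto simp: left_commensurated_def)
  have "g <#\<^bsub>G\<^esub> (A \<inter> B) = (g <#\<^bsub>G\<^esub> A) \<inter> (g <#\<^bsub>G\<^esub> B)"
  proof -
    have "inj_on (\<lambda>x. g \<otimes>\<^bsub>G\<^esub> x) (carrier G)" using g by (auto simp: inj_on_def)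
    then have "(\<lambda>x. g \<otimes>\<^bsub>G\<^esub> x) ` (A \<inter> B) = (\<lambda>x. g \<otimes>\<^bsub>G\<^esub> x) ` A \<inter> (\<lambda>x. g \<otimes>\<^bsub>G\<^esub> x) ` B"
      using AB by (rule inj_on_image_Int)
    then show ?thesis by (simp add: l_coset_def UNION_singleton_eq_range)
  qed
  then have "sym_diff (g <#\<^bsub>G\<^esub> (A \<inter> B)) (A \<inter> B)
      \<subseteq> sym_diff (g <#\<^bsub>G\<^esub> A) A \<union> sym_diff (g <#\<^bsub>G\<^esub> B) B"
    by auto
  moreover have "finite (sym_diff (g <#\<^bsub>G\<^esub> A) A \<union> sym_diff (g <#\<^bsub>G\<^esub> B) B)"
    using assms g by (auto simp: left_commensurated_def)
  ultimately show "finite (sym_diff (g <#\<^bsub>G\<^esub> (A \<inter> B)) (A \<inter> B))"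
    by (rule finite_subset)
qed

lemma end_algebra_le_iff:
  assumes "group G" "left_commensurated G A" "left_commensurated G B"
  shows "(almost_equal_rel G `` {A}) \<sqsubseteq>\<^bsub>end_algebra G\<^esub> (almost_equal_rel G `` {B})
     \<longleftrightarrow> finite (A - B)"
proof -
  have le: "(almost_equal_rel G `` {A}) \<sqsubseteq>\<^bsub>end_algebra G\<^esub> (almost_equal_rel G `` {B})
     \<longleftrightarrow> (\<exists>C D. (A, C) \<in> almost_equal_rel G \<and> (B, D) \<in> almost_equal_rel G \<and> C \<subseteq> D)"
    by (simp only: end_algebra_def gorder.simps Bex_def Image_singleton_iff) blast
  show ?thesis unfolding le
  proof
    assume "\<exists>C D. (A, C) \<in> almost_equal_rel G \<and> (B, D) \<in> almost_equal_rel G \<and> C \<subseteq> D"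
    then obtain C D where CD: "(A, C) \<in> almost_equal_rel G" "(B, D) \<in> almost_equal_rel G" "C \<subseteq> D"
      by blast
    then have "finite (sym_diff A C \<union> sym_diff B D)"
      by (simp add: almost_equal_rel_def)
    moreover have "A - B \<subseteq> sym_diff A C \<union> sym_diff B D" using CD(3) by blast
    ultimately show "finite (A - B)" by (rule rev_finite_subset)
  next
    assume "finite (A - B)"
    moreover have "sym_diff A (A \<inter> B) \<subseteq> A - B" by blast
    ultimately have "finite (sym_diff A (A \<inter> B))" by (rule rev_finite_subset)
    then have "(A, A \<inter> B) \<in> almost_equal_rel G"
      using assms(2) left_commensurated_Int[OF assms] unfolding almost_equal_rel_def
      by (simp only: mem_Collect_eq case_prod_conv)
    moreover have "(B, B) \<in> almost_equal_rel G"
      using assms(3) by (simp add: almost_equal_rel_def)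
    ultimately show "\<exists>C D. (A, C) \<in> almost_equal_rel G \<and> (B, D) \<in> almost_equal_rel G \<and> C \<subseteq> D"
      by (intro exI[of _ "A \<inter> B"] exI[of _ B]) simp
  qed
qed

end

theory Submission
  imports Defs "HOL-Algebra.Generated_Groups"
begin

text \<open>An isolated end is an atom of the end algebra: an infinite left commensurated set \<open>A\<close> that no left
commensurated set splits into two infinite parts. If the group is infinitely-ended, an atom comes
with four disjoint infinite left commensurated sets \<open>P\<close>, \<open>Q\<close>, \<open>R\<close>, \<open>S\<close>. The heart of the proof is that this
is impossible.

Suppose first that the group is finitely generated, and draw its Cayley graph for left
multiplication, so that commensurated sets are those with finite boundary and right translations are
automorphisms. Put \<open>B = P \<union> Q\<close>. For all but finitely many \<open>x\<close> in \<open>A\<close>, right translation by \<open>x\<close> carries the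
finite boundary of \<open>B\<close> into \<open>A\<close>, and the boundary of \<open>A\<close> lies on one side of the translate of \<open>B\<close>,
because translation by the inverse of \<open>x\<close> leaves it on the side of \<open>B\<close> that contains that inverse. Then
the part of the complement of \<open>A\<close> that lies on the other side of the translate has no boundary, so
it is empty by connectedness (\<open>corner_empty\<close>). That other side, a translate of \<open>B\<close> or of its
complement, is thus contained in \<open>A\<close>. It contains the translates of two of the four sets, and so \<open>A\<close> is split
(\<open>unsplittable_no_four_pieces\<close>).

In general the argument is run over the subgroup generated by a set \<open>T\<close>, one coset at a time. It
needs that this subgroup meets each of the four sets in an infinite set, and that \<open>A\<close> is larger than the set
of exceptional elements, which is finite for finite \<open>T\<close> and countable for countable \<open>T\<close>. A finite
\<open>T\<close> exists if the group is not locally finite, and a countable \<open>T\<close> suffices if the group is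
uncountable, because infinite commensurated sets are then uncountable. In a countable locally
finite group, every infinite commensurated set can be split by hand
(\<open>locally_finite_countable_splits\<close>).

The topological part is Stone duality and Brouwer's characterization of the Cantor space. The space
of ends is compact with a basis of clopen sets; if it is metrizable, countably many of these
separate the points, and as there are no isolated points a binary tree of clopen sets codes the
ends by sequences (\<open>homeomorphic_cantor_space\<close>).\<close>

section \<open>Left commensurated sets\<close>

text \<open>The boundary of \<open>A\<close> in direction \<open>g\<close>: with edges drawn from \<open>x\<close> to \<open>g \<otimes> x\<close>, these are the
starting points of the edges that join \<open>A\<close> to its complement.\<close>

definition jumps :: "('a, 'b) monoid_scheme \<Rightarrow> 'a \<Rightarrow> 'a set \<Rightarrow> 'a set" where
  "jumps G g A = {x \<in> carrier G. (x \<in> A) \<noteq> (g \<otimes>\<^bsub>G\<^esub> x \<in> A)}"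

definition end_class :: "('a, 'b) monoid_scheme \<Rightarrow> 'a set \<Rightarrow> 'a set set" where
  "end_class G A = almost_equal_rel G `` {A}"

text \<open>For infinite left commensurated sets this says that the class is an atom of the end algebra.
Letting finite sets qualify too spares a case distinction when a set is tested for a splitting.\<close>

definition unsplittable :: "('a, 'b) monoid_scheme \<Rightarrow> 'a set \<Rightarrow> bool" where
  "unsplittable G A \<longleftrightarrow>
     (\<forall>B. left_commensurated G B \<longrightarrow> finite (A \<inter> B) \<or> finite (A - B))"

context group
begin

text \<open>Commensuration becomes a condition on boundaries, which behave well under Boolean operations:
complements have the same boundary, and the boundary of a union lies in the union of the
boundaries.\<close>

lemma left_commensurated_iff_jumps:
  "left_commensurated G A \<longleftrightarrow> A \<subseteq> carrier G \<and> (\<forall>g\<in>carrier G. finite (jumps G g A))"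
proof -
  have eq: "sym_diff (g <# A) A = jumps G (inv g) A" if A: "A \<subseteq> carrier G" and g: "g \<in> carrier G" for g
  proof -
    have "y \<in> g <# A \<longleftrightarrow> y \<in> carrier G \<and> inv g \<otimes> y \<in> A" for y
    proof
      assume "y \<in> g <# A"
      then show "y \<in> carrier G \<and> inv g \<otimes> y \<in> A"
        using A g by (auto simp: l_coset_def subset_iff m_assoc[symmetric])
    next
      assume y: "y \<in> carrier G \<and> inv g \<otimes> y \<in> A"
      then have "y = g \<otimes> (inv g \<otimes> y)" using g by (simp add: m_assoc[symmetric])
      then show "y \<in> g <# A" using y unfolding l_coset_def by blast
    qed
    then show ?thesis using A unfolding jumps_def by blast
  qed
  show ?thesis
  proof
    assume l: "left_commensurated G A"
    then have A: "A \<subseteq> carrier G" by (simp add: left_commensurated_def)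
    have "finite (jumps G g A)" if g: "g \<in> carrier G" for g
    proof -
      have "finite (sym_diff (inv g <# A) A)"
        using l inv_closed[OF g] unfolding left_commensurated_def by blast
      then show ?thesis using eq[OF A inv_closed[OF g]] g by simp
    qed
    with A show "A \<subseteq> carrier G \<and> (\<forall>g\<in>carrier G. finite (jumps G g A))" by blast
  next
    assume "A \<subseteq> carrier G \<and> (\<forall>g\<in>carrier G. finite (jumps G g A))"
    then show "left_commensurated G A" by (simp add: left_commensurated_def eq)
  qed
qed

lemma left_commensurated_subset: "left_commensurated G A \<Longrightarrow> A \<subseteq> carrier G"
  by (simp add: left_commensurated_def)

lemma finite_jumps: "left_commensurated G A \<Longrightarrow> g \<in> carrier G \<Longrightarrow> finite (jumps G g A)"
  by (simp add: left_commensurated_iff_jumps)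

lemma jumps_compl: "g \<in> carrier G \<Longrightarrow> jumps G g (carrier G - A) = jumps G g A"
  by (auto simp: jumps_def)

lemma left_commensurated_compl: "left_commensurated G A \<Longrightarrow> left_commensurated G (carrier G - A)"
  by (simp add: left_commensurated_iff_jumps jumps_compl)

lemma left_commensurated_Un:
  assumes "left_commensurated G A" "left_commensurated G B"
  shows "left_commensurated G (A \<union> B)"
proof -
  have "jumps G g (A \<union> B) \<subseteq> jumps G g A \<union> jumps G g B" for g
    by (auto simp: jumps_def)
  then show ?thesis
    using assms by (meson finite_UnI finite_subset left_commensurated_iff_jumps Un_least)
qed

lemma left_commensurated_diff:
  assumes "left_commensurated G A" "left_commensurated G B"
  shows "left_commensurated G (A - B)"
proof -
  have "A - B = A \<inter> (carrier G - B)" using left_commensurated_subset[OF assms(1)] by blast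
  then show ?thesis
    using left_commensurated_Int[OF is_group assms(1) left_commensurated_compl[OF assms(2)]] by simp
qed

lemma left_commensurated_carrier: "left_commensurated G (carrier G)"
proof -
  have "jumps G g (carrier G) = {}" if "g \<in> carrier G" for g
    using that by (auto simp: jumps_def)
  then show ?thesis by (simp add: left_commensurated_iff_jumps)
qed

lemma finite_translate_preimage:
  assumes "finite F" "g \<in> carrier G"
  shows "finite {x \<in> carrier G. g \<otimes> x \<in> F}"
proof -
  have "{x \<in> carrier G. g \<otimes> x \<in> F} \<subseteq> (\<lambda>y. inv g \<otimes> y) ` F"
  proof
    fix x assume x: "x \<in> {x \<in> carrier G. g \<otimes> x \<in> F}"
    then have "x = inv g \<otimes> (g \<otimes> x)" using assms(2) by (simp add: m_assoc[symmetric])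
    then show "x \<in> (\<lambda>y. inv g \<otimes> y) ` F" using x by blast
  qed
  then show ?thesis using assms(1) by (meson finite_imageI finite_subset)
qed

lemma left_commensurated_finite:
  assumes "finite F" "F \<subseteq> carrier G"
  shows "left_commensurated G F"
proof -
  have "jumps G g F \<subseteq> F \<union> {x \<in> carrier G. g \<otimes> x \<in> F}" for g by (auto simp: jumps_def)
  then show ?thesis
    using assms finite_translate_preimage left_commensurated_iff_jumps
    by (meson finite_UnI finite_subset)
qed

text \<open>Right translation commutes with left translation, so it carries boundaries to boundaries. This is
the symmetry that moves pieces of the group into an atom.\<close>

lemma left_commensurated_right_translate:
  assumes "left_commensurated G A" "x \<in> carrier G"
  shows "left_commensurated G (A #> x)"
proof -
  have A: "A \<subseteq> carrier G" using assms(1) by (rule left_commensurated_subset)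
  have mem: "y \<in> A #> x \<longleftrightarrow> y \<otimes> inv x \<in> A" if y: "y \<in> carrier G" for y
  proof
    assume "y \<in> A #> x"
    then show "y \<otimes> inv x \<in> A" using A assms(2) by (auto simp: r_coset_def subset_iff m_assoc)
  next
    assume "y \<otimes> inv x \<in> A"
    moreover have "y = (y \<otimes> inv x) \<otimes> x" using y assms(2) by (simp add: m_assoc)
    ultimately show "y \<in> A #> x" unfolding r_coset_def by blast
  qed
  have "jumps G g (A #> x) \<subseteq> (\<lambda>y. y \<otimes> x) ` jumps G g A" if g: "g \<in> carrier G" for g
  proof
    fix y assume "y \<in> jumps G g (A #> x)"
    then have y: "y \<in> carrier G" and "(y \<in> A #> x) \<noteq> (g \<otimes> y \<in> A #> x)" by (auto simp: jumps_def)
    then have "y \<otimes> inv x \<in> jumps G g A" using mem g assms(2) by (simp add: jumps_def m_assoc)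
    moreover have "y = (y \<otimes> inv x) \<otimes> x" using y assms(2) by (simp add: m_assoc)
    ultimately show "y \<in> (\<lambda>y. y \<otimes> x) ` jumps G g A" by blast
  qed
  moreover have "A #> x \<subseteq> carrier G" using A assms(2) by (rule r_coset_subset_G)
  ultimately show ?thesis
    using assms(1) left_commensurated_iff_jumps by (meson finite_imageI finite_subset)
qed

section \<open>Moving four pieces into an atom\<close>

text \<open>Once the parts of two disjoint sets inside \<open>\<Gamma>\<close> have been translated into \<open>A\<close>, the translate of the
first set splits \<open>A\<close>.\<close>

lemma unsplittable_no_two_translated_pieces:
  assumes A: "unsplittable G A"
    and P: "left_commensurated G P" "infinite (\<Gamma> \<inter> P)"
    and Q: "Q \<subseteq> carrier G" "infinite (\<Gamma> \<inter> Q)"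
    and disj: "P \<inter> Q = {}"
    and x: "x \<in> carrier G"
    and sub: "\<And>g. g \<in> \<Gamma> \<Longrightarrow> g \<in> P \<union> Q \<Longrightarrow> g \<otimes> x \<in> A"
  shows False
proof -
  have Pc: "P \<subseteq> carrier G" using P(1) by (rule left_commensurated_subset)
  have inj: "inj_on (\<lambda>g. g \<otimes> x) (carrier G)" using x by (simp add: inj_on_def)
  have "(\<lambda>g. g \<otimes> x) ` (\<Gamma> \<inter> P) \<subseteq> A \<inter> (P #> x)"
    using sub by (auto simp: r_coset_def)
  moreover have "infinite ((\<lambda>g. g \<otimes> x) ` (\<Gamma> \<inter> P))"
    using P(2) Pc inj by (meson finite_imageD inf_le2 inj_on_subset order_trans)
  moreover have "(\<lambda>g. g \<otimes> x) ` (\<Gamma> \<inter> Q) \<subseteq> A - (P #> x)"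
  proof
    fix y assume "y \<in> (\<lambda>g. g \<otimes> x) ` (\<Gamma> \<inter> Q)"
    then obtain q where q: "q \<in> \<Gamma>" "q \<in> Q" "y = q \<otimes> x" by blast
    have "y \<notin> P #> x"
    proof
      assume "y \<in> P #> x"
      then obtain p where p: "p \<in> P" "y = p \<otimes> x" by (auto simp: r_coset_def)
      moreover have "p \<in> carrier G" "q \<in> carrier G" using p q Q(1) Pc by blast+
      ultimately have "p = q" using q x by simp
      then show False using p q disj by blast
    qed
    then show "y \<in> A - (P #> x)" using q sub by blast
  qed
  moreover have "infinite ((\<lambda>g. g \<otimes> x) ` (\<Gamma> \<inter> Q))"
    using Q inj by (meson finite_imageD inf_le2 inj_on_subset order_trans)
  moreover have "left_commensurated G (P #> x)"
    using P(1) x by (rule left_commensurated_right_translate)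
  ultimately show False
    using A unfolding unsplittable_def by (meson finite_subset)
qed

text \<open>The corner formed by the complement of \<open>A\<close> and the complement of the translate of \<open>B\<close> by \<open>x\<close> could
only have boundary points on the boundary of \<open>A\<close> or on that of the translate. The hypotheses place
the former in the translate of \<open>B\<close> and the latter in \<open>A\<close>, outside the corner. So the corner is invariant
under the group generated by \<open>T\<close>; as it misses \<open>x\<close>, it misses the whole coset of \<open>x\<close>.\<close>

lemma corner_empty:
  assumes T: "T \<subseteq> carrier G" "\<And>t. t \<in> T \<Longrightarrow> inv t \<in> T"
    and x: "x \<in> carrier G" "x \<in> A"
    and jB: "\<And>t d. t \<in> T \<Longrightarrow> d \<in> jumps G t B \<Longrightarrow> d \<otimes> x \<in> A"
    and jA: "\<And>t d. t \<in> T \<Longrightarrow> d \<in> jumps G t A \<Longrightarrow> d \<otimes> inv x \<in> B"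
    and g: "g \<in> generate G T" "g \<notin> B"
  shows "g \<otimes> x \<in> A"
proof (rule ccontr)
  \<comment> \<open>The corner, translated back by the inverse of \<open>x\<close>.\<close>
  define C where "C = {h \<in> carrier G. h \<notin> B \<and> h \<otimes> x \<notin> A}"
  have step: "t \<otimes> h \<in> C" if t: "t \<in> T" and h: "h \<in> C" for t h
  proof -
    have tc: "t \<in> carrier G" and hc: "h \<in> carrier G" "h \<notin> B" "h \<otimes> x \<notin> A"
      using t h T(1) by (auto simp: C_def)
    have "t \<otimes> h \<notin> B"
      using jB[OF t, of h] hc by (auto simp: jumps_def)
    moreover have "t \<otimes> (h \<otimes> x) \<notin> A"
    proof
      assume "t \<otimes> (h \<otimes> x) \<in> A"
      then have "h \<otimes> x \<in> jumps G t A" using hc x by (simp add: jumps_def)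
      then have "h \<otimes> x \<otimes> inv x \<in> B" by (rule jA[OF t])
      then show False using hc x by (simp add: m_assoc)
    qed
    ultimately show ?thesis using tc hc x by (simp add: C_def m_assoc)
  qed
  have inv: "\<gamma> \<otimes> h \<in> C" if "\<gamma> \<in> generate G T" "h \<in> C" for \<gamma> h
    using that
  proof (induction arbitrary: h rule: generate.induct)
    case one
    then show ?case by (simp add: C_def)
  next
    case (incl t)
    then show ?case by (simp add: step)
  next
    case (inv t)
    then show ?case by (simp add: step T(2))
  next
    case (eng a b)
    then have "a \<in> carrier G" "b \<in> carrier G" "h \<in> carrier G"
      using generate_in_carrier[OF T(1)] by (auto simp: C_def)
    then show ?case using eng by (simp add: m_assoc)
  qed
  assume "g \<otimes> x \<notin> A"
  moreover have gc: "g \<in> carrier G" using generate_in_carrier[OF T(1) g(1)] .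
  ultimately have "g \<in> C" using g(2) by (simp add: C_def)
  then have "inv g \<otimes> g \<in> C" using inv generate_m_inv_closed[OF T(1) g(1)] by blast
  then show False using gc x by (simp add: C_def)
qed

text \<open>The elements \<open>x\<close> of \<open>A\<close> for which the corner argument may fail: translating by \<open>x\<close> does not carry the boundary
of \<open>B\<close> into \<open>A\<close>, or translating by the inverse of \<open>x\<close> does not carry the boundary of \<open>A\<close> to the side of
\<open>B\<close> on which that inverse lies.\<close>

definition exceptional :: "'a set \<Rightarrow> 'a set \<Rightarrow> 'a set \<Rightarrow> 'a set" where
  "exceptional T A B =
     (\<Union>t\<in>T. (\<Union>d\<in>jumps G t B. {x \<in> A. d \<otimes> x \<notin> A}) \<union>
            (\<Union>d\<in>jumps G t A. {x \<in> A. (inv x \<in> B) \<noteq> (d \<otimes> inv x \<in> B)}))"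

text \<open>Each boundary is finite, and each boundary point \<open>d\<close> excludes only finitely many \<open>x\<close>, since left translation
by \<open>d\<close> changes \<open>A\<close> and \<open>B\<close> only by finite sets. Hence the exceptional set is finite for finite \<open>T\<close> and
countable for countable \<open>T\<close>.\<close>

lemma finite_exceptional_piece:
  assumes A: "left_commensurated G A" and B: "left_commensurated G B" and t: "t \<in> carrier G"
  shows "finite ((\<Union>d\<in>jumps G t B. {x \<in> A. d \<otimes> x \<notin> A}) \<union>
            (\<Union>d\<in>jumps G t A. {x \<in> A. (inv x \<in> B) \<noteq> (d \<otimes> inv x \<in> B)}))"
proof -
  have Ac: "A \<subseteq> carrier G" using A by (rule left_commensurated_subset)
  have "finite {x \<in> A. d \<otimes> x \<notin> A}" if "d \<in> carrier G" for d
    using finite_jumps[OF A that] Ac by (elim rev_finite_subset) (auto simp: jumps_def)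
  moreover have "finite {x \<in> A. (inv x \<in> B) \<noteq> (d \<otimes> inv x \<in> B)}" if "d \<in> carrier G" for d
  proof -
    have "{x \<in> A. (inv x \<in> B) \<noteq> (d \<otimes> inv x \<in> B)} \<subseteq> (\<lambda>y. inv y) ` jumps G d B"
    proof
      fix x assume x: "x \<in> {x \<in> A. (inv x \<in> B) \<noteq> (d \<otimes> inv x \<in> B)}"
      then have "inv x \<in> jumps G d B" "x = inv (inv x)" using Ac by (auto simp: jumps_def)
      then show "x \<in> (\<lambda>y. inv y) ` jumps G d B" by blast
    qed
    then show ?thesis using finite_jumps[OF B that] by (meson finite_imageI finite_subset)
  qed
  moreover have "finite (jumps G t A)" "finite (jumps G t B)"
    using A B t by (simp_all add: finite_jumps)
  ultimately show ?thesis by (auto simp: jumps_def)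
qed

text \<open>For a non-exceptional \<open>x\<close>, the inverse of \<open>x\<close> lies in \<open>P \<union> Q\<close> or outside it. Whichever side contains it,
the empty corner forces the opposite side, restricted to the generated group, into \<open>A\<close> after
translation by \<open>x\<close>. Both sides contain two infinite pieces, so either way \<open>A\<close> is split. This is why
four pieces are taken: two on each side.\<close>

lemma unsplittable_no_four_pieces:
  assumes A: "left_commensurated G A" "unsplittable G A"
    and com: "left_commensurated G P" "left_commensurated G Q"
      "left_commensurated G R" "left_commensurated G S"
    and disj: "P \<inter> Q = {}" "R \<inter> S = {}" "(P \<union> Q) \<inter> (R \<union> S) = {}"
    and T: "T \<subseteq> carrier G" "\<And>t. t \<in> T \<Longrightarrow> inv t \<in> T"
    and inf: "infinite (generate G T \<inter> P)" "infinite (generate G T \<inter> Q)"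
      "infinite (generate G T \<inter> R)" "infinite (generate G T \<inter> S)"
  shows "A \<subseteq> exceptional T A (P \<union> Q)"
proof (rule ccontr)
  let ?B = "P \<union> Q"
  assume "\<not> A \<subseteq> exceptional T A ?B"
  then obtain x where x: "x \<in> A" "x \<notin> exceptional T A ?B" by blast
  have xc: "x \<in> carrier G" using x(1) left_commensurated_subset[OF A(1)] by blast
  have jB: "d \<otimes> x \<in> A" if "t \<in> T" "d \<in> jumps G t ?B" for t d
    using that x by (auto simp: exceptional_def)
  have jA: "(inv x \<in> ?B) = (d \<otimes> inv x \<in> ?B)" if "t \<in> T" "d \<in> jumps G t A" for t d
    using that x unfolding exceptional_def by blast
  have sub: "P \<subseteq> carrier G" "Q \<subseteq> carrier G" "R \<subseteq> carrier G" "S \<subseteq> carrier G"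
    using com by (simp_all add: left_commensurated_subset)
  show False
  proof (cases "inv x \<in> ?B")
    case True
    have "g \<otimes> x \<in> A" if "g \<in> generate G T" "g \<in> R \<union> S" for g
    proof (rule corner_empty[OF T xc x(1)])
      show "d \<otimes> inv x \<in> ?B" if "t \<in> T" "d \<in> jumps G t A" for t d
        using jA[OF that] True by blast
      show "g \<notin> ?B" using that disj by blast
    qed (use jB that in auto)
    then show False
      using unsplittable_no_two_translated_pieces[OF A(2) com(3) inf(3) sub(4) inf(4) disj(2) xc]
      by blast
  next
    case False
    have "g \<otimes> x \<in> A" if "g \<in> generate G T" "g \<in> ?B" for g
    proof (rule corner_empty[OF T xc x(1)])
      show "d \<otimes> x \<in> A" if "t \<in> T" "d \<in> jumps G t (carrier G - ?B)" for t d
        using that jB jumps_compl[of t ?B] T(1) by blast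
      show "d \<otimes> inv x \<in> carrier G - ?B" if "t \<in> T" "d \<in> jumps G t A" for t d
        using jA[OF that] False that xc by (auto simp: jumps_def)
    qed (use that in auto)
    then show False
      using unsplittable_no_two_translated_pieces[OF A(2) com(1) inf(1) sub(2) inf(2) disj(1) xc]
      by blast
  qed
qed

section \<open>Atoms leave no room for four disjoint infinite sets\<close>

text \<open>A countable \<open>A\<close> would be disjoint from its translate by any \<open>g\<close> outside the countable set of quotients
of elements of \<open>A\<close>.\<close>

lemma infinite_left_commensurated_uncountable:
  assumes "uncountable (carrier G)" "left_commensurated G A" "infinite A"
  shows "uncountable A"
proof
  assume "countable A"
  then have "countable ((\<lambda>(a, b). a \<otimes> inv b) ` (A \<times> A))" by simp
  then obtain g where g: "g \<in> carrier G" "g \<notin> (\<lambda>(a, b). a \<otimes> inv b) ` (A \<times> A)"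
    using assms(1) by (meson countable_subset subsetI)
  have Ac: "A \<subseteq> carrier G" using assms(2) by (rule left_commensurated_subset)
  have "A \<subseteq> jumps G g A"
  proof
    fix x assume x: "x \<in> A"
    have "g \<otimes> x \<notin> A"
    proof
      assume "g \<otimes> x \<in> A"
      moreover have "g = (g \<otimes> x) \<otimes> inv x" using g(1) x Ac by (auto simp: m_assoc)
      ultimately show False using g(2) x by force
    qed
    then show "x \<in> jumps G g A" using x Ac by (auto simp: jumps_def)
  qed
  then show False using finite_jumps[OF assms(2) g(1)] assms(3) finite_subset by blast
qed

text \<open>Only finitely many right cosets of the generated group contain boundary points of \<open>A\<close>. If \<open>A\<close> meets
another one, it contains that whole infinite coset; otherwise finitely many cosets cover \<open>A\<close>.\<close>

lemma infinite_meets_coset_of_fg: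
  assumes S: "finite S" "S \<subseteq> carrier G" and inf: "infinite (generate G S)"
    and A: "left_commensurated G A" "infinite A"
  obtains y where "y \<in> carrier G" "infinite (A \<inter> (generate G S #> y))"
proof -
  let ?\<Gamma> = "generate G S"
  define D where "D = (\<Union>s\<in>S \<union> (\<lambda>s. inv s) ` S. jumps G s A)"
  have fD: "finite D" using S finite_jumps[OF A(1)] by (auto simp: D_def)
  have Dc: "D \<subseteq> carrier G" by (auto simp: D_def jumps_def)
  have Ac: "A \<subseteq> carrier G" using A(1) by (rule left_commensurated_subset)
  have sg: "subgroup ?\<Gamma> G" using S(2) by (rule generate_is_subgroup)
  have \<Gamma>c: "?\<Gamma> \<subseteq> carrier G" using S(2) by (rule generate_incl)
  have "\<exists>y\<in>carrier G. infinite (A \<inter> (?\<Gamma> #> y))"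
  proof (cases "\<exists>b\<in>A. D \<inter> (?\<Gamma> #> b) = {}")
    case True
    then obtain b where b: "b \<in> A" "D \<inter> (?\<Gamma> #> b) = {}" by blast
    have bc: "b \<in> carrier G" using b Ac by blast
    have nD: "\<gamma> \<otimes> b \<notin> D" if "\<gamma> \<in> ?\<Gamma>" for \<gamma>
      using that b(2) by (auto simp: r_coset_def)
    have step: "s \<otimes> (\<gamma> \<otimes> b) \<in> A"
      if "s \<in> S \<union> (\<lambda>s. inv s) ` S" "\<gamma> \<in> ?\<Gamma>" "\<gamma> \<otimes> b \<in> A" for s \<gamma>
      using nD[OF that(2)] that Ac unfolding D_def jumps_def by blast
    have "h \<otimes> (\<gamma> \<otimes> b) \<in> A" if "h \<in> ?\<Gamma>" "\<gamma> \<in> ?\<Gamma>" "\<gamma> \<otimes> b \<in> A" for h \<gamma>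
      using that
    proof (induction arbitrary: \<gamma> rule: generate.induct)
      case one
      then show ?case using Ac by auto
    next
      case (incl s)
      then show ?case by (simp add: step)
    next
      case (inv s)
      then show ?case by (simp add: step)
    next
      case (eng h1 h2)
      have c: "h1 \<in> carrier G" "h2 \<in> carrier G" "\<gamma> \<in> carrier G"
        using eng \<Gamma>c by auto
      have "h2 \<otimes> \<gamma> \<in> ?\<Gamma>" using eng by (simp add: generate.eng)
      moreover have "(h2 \<otimes> \<gamma>) \<otimes> b \<in> A" using eng c bc by (simp add: m_assoc)
      ultimately have "h1 \<otimes> ((h2 \<otimes> \<gamma>) \<otimes> b) \<in> A" using eng by blast
      then show ?case using c bc by (simp add: m_assoc)
    qed
    from this[of _ \<one>] have "?\<Gamma> #> b \<subseteq> A"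
      using b bc by (auto simp: r_coset_def generate.one)
    moreover have "inj_on (\<lambda>h. h \<otimes> b) ?\<Gamma>"
      by (rule inj_on_subset[OF _ \<Gamma>c]) (use bc in \<open>auto simp: inj_on_def\<close>)
    moreover have "?\<Gamma> #> b = (\<lambda>h. h \<otimes> b) ` ?\<Gamma>" by (auto simp: r_coset_def)
    ultimately have "infinite (A \<inter> (?\<Gamma> #> b))"
      using inf by (simp add: Int_absorb1 finite_image_iff)
    then show ?thesis using bc by blast
  next
    case False
    have "A \<subseteq> (\<Union>d\<in>D. A \<inter> (?\<Gamma> #> d))"
    proof
      fix b assume b: "b \<in> A"
      then obtain d where d: "d \<in> D" "d \<in> ?\<Gamma> #> b" using False by blast
      have "b \<in> ?\<Gamma> #> b" using b Ac sg by (meson rcos_self subsetD)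
      moreover have "?\<Gamma> #> b = ?\<Gamma> #> d" using d b Ac sg by (meson repr_independence subsetD)
      ultimately show "b \<in> (\<Union>d\<in>D. A \<inter> (?\<Gamma> #> d))" using b d by blast
    qed
    then obtain d where "d \<in> D" "infinite (A \<inter> (?\<Gamma> #> d))"
      using fD A(2) by (meson finite_UN finite_subset)
    then show ?thesis using Dc by blast
  qed
  then show ?thesis using that by blast
qed

text \<open>Exhaust the group by an increasing sequence of finite subgroups \<open>\<Gamma> n\<close>. All but finitely many cosets
of \<open>\<Gamma> n\<close> lie inside \<open>A\<close> or outside it, so disjoint cosets \<open>L n\<close> of \<open>\<Gamma> n\<close> can be chosen one after the other inside \<open>A\<close>.
A fixed \<open>g\<close> preserves all but finitely many of them, so every union of some of the \<open>L n\<close> is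
commensurated, and the union over even \<open>n\<close> splits \<open>A\<close>.\<close>

lemma locally_finite_countable_splits:
  assumes cnt: "countable (carrier G)"
    and lf: "\<And>S. finite S \<Longrightarrow> S \<subseteq> carrier G \<Longrightarrow> finite (generate G S)"
    and A: "left_commensurated G A" "infinite A"
  shows "\<not> unsplittable G A"
proof -
  have Ac: "A \<subseteq> carrier G" using A(1) by (rule left_commensurated_subset)
  obtain e :: "nat \<Rightarrow> 'a" where e: "range e = carrier G"
    using cnt by (metis one_closed empty_iff range_from_nat_into)
  define \<Gamma> where "\<Gamma> n = generate G (e ` {..n})" for n
  have ec: "e ` {..n} \<subseteq> carrier G" for n using e by blast
  have fin: "finite (\<Gamma> n)" for n unfolding \<Gamma>_def by (rule lf) (use ec in auto)
  have sg: "subgroup (\<Gamma> n) G" for n unfolding \<Gamma>_def by (rule generate_is_subgroup[OF ec])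
  have mem: "e m \<in> \<Gamma> n" if "m \<le> n" for m n
    using that by (auto simp: \<Gamma>_def intro: generate.incl)
  let ?Q = "\<lambda>n F F'. F \<subseteq> F' \<and> F' - F \<noteq> {} \<and> F' - F \<subseteq> A \<and>
    (\<forall>g\<in>\<Gamma> n. \<forall>y\<in>F' - F. g \<otimes> y \<in> F' - F)"
  \<comment> \<open>\<open>F n\<close> collects the cosets chosen before stage \<open>n\<close>; the next coset avoids it.\<close>
  have "\<exists>F. \<forall>n. finite (F n) \<and> ?Q n (F n) (F (Suc n))"
  proof (rule dependent_nat_choice[where P = "\<lambda>_. finite"])
    show "\<exists>F::'a set. finite F" by blast
  next
    fix F :: "'a set" and n assume F: "finite F"
    have "finite (\<Union>g\<in>\<Gamma> n. jumps G g A \<union> {x \<in> carrier G. g \<otimes> x \<in> F})"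
      using fin finite_jumps[OF A(1)] finite_translate_preimage[OF F] sg
      by (meson finite_UN_I finite_UnI subgroup.mem_carrier)
    then obtain x where x: "x \<in> A"
      "x \<notin> (\<Union>g\<in>\<Gamma> n. jumps G g A \<union> {x \<in> carrier G. g \<otimes> x \<in> F})"
      using A(2) by (meson finite_subset subsetI)
    have xc: "x \<in> carrier G" using x Ac by blast
    have sub: "\<Gamma> n #> x \<subseteq> A - F"
      using x xc by (auto simp: r_coset_def jumps_def)
    have "x \<in> \<Gamma> n #> x" using xc sg by (rule rcos_self)
    moreover have "g \<otimes> y \<in> \<Gamma> n #> x" if g: "g \<in> \<Gamma> n" and y: "y \<in> \<Gamma> n #> x" for g y
    proof -
      obtain h where h: "h \<in> \<Gamma> n" "y = h \<otimes> x" using y by (auto simp: r_coset_def)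
      then have "g \<otimes> y = (g \<otimes> h) \<otimes> x"
        using xc subgroup.mem_carrier[OF sg g] subgroup.mem_carrier[OF sg h(1)] by (simp add: m_assoc)
      moreover have "g \<otimes> h \<in> \<Gamma> n" using g h sg by (simp add: subgroup.m_closed)
      ultimately show ?thesis by (auto simp: r_coset_def)
    qed
    moreover have "finite (\<Gamma> n #> x)" using fin by (auto simp: r_coset_def)
    moreover have "F \<union> (\<Gamma> n #> x) - F = \<Gamma> n #> x" using sub by blast
    ultimately show "\<exists>F'. finite F' \<and> ?Q n F F'"
      using F sub by (intro exI[of _ "F \<union> (\<Gamma> n #> x)"]) auto
  qed
  then obtain F where F: "\<And>n. finite (F n)" "\<And>n. F n \<subseteq> F (Suc n)"
    and Fne: "\<And>n. F (Suc n) - F n \<noteq> {}" and FA: "\<And>n. F (Suc n) - F n \<subseteq> A"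
    and Finv: "\<And>n g y. g \<in> \<Gamma> n \<Longrightarrow> y \<in> F (Suc n) - F n \<Longrightarrow> g \<otimes> y \<in> F (Suc n) - F n"
    by metis
  define L where "L n = F (Suc n) - F n" for n
  have mono: "F m \<subseteq> F n" if "m \<le> n" for m n
    using F(2) that by (rule lift_Suc_mono_le)
  have L_F: "L n \<subseteq> F m" if "n < m" for n m
    using mono[of "Suc n" m] that by (auto simp: L_def)
  have disj: "m = n" if "z \<in> L m" "z \<in> L n" for z m n
    using that L_F[of m n] L_F[of n m] by (cases m n rule: linorder_cases) (auto simp: L_def)
  have "\<forall>n. \<exists>z. z \<in> L n" using Fne unfolding L_def by blast
  then obtain c where c: "\<And>n. c n \<in> L n" by metis
  have injc: "inj c" using c disj by (metis injI)
  define B where "B = (\<Union>n. L (2 * n))"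
  have BA: "B \<subseteq> A" using FA by (auto simp: B_def L_def)
  have "range (\<lambda>n. c (2 * n)) \<subseteq> A \<inter> B" using c BA unfolding B_def by blast
  moreover have "inj (\<lambda>n. c (2 * n))" by (rule injI) (use injD[OF injc] in force)
  ultimately have i1: "infinite (A \<inter> B)" by (meson finite_subset range_inj_infinite)
  have "c (2 * n + 1) \<in> A - B" for n
  proof -
    have "c (2 * n + 1) \<notin> L (2 * m)" for m
    proof
      assume "c (2 * n + 1) \<in> L (2 * m)"
      with c[of "2 * n + 1"] have "2 * n + 1 = 2 * m" by (rule disj)
      then show False by presburger
    qed
    then show ?thesis using c[of "2 * n + 1"] FA by (auto simp: B_def L_def)
  qed
  then have "range (\<lambda>n. c (2 * n + 1)) \<subseteq> A - B" by blast
  moreover have "inj (\<lambda>n. c (2 * n + 1))" by (rule injI) (use injD[OF injc] in force)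
  ultimately have i2: "infinite (A - B)" by (meson finite_subset range_inj_infinite)
  have "finite (jumps G g B)" if g: "g \<in> carrier G" for g
  proof -
    obtain m where m: "g = e m" using g e by blast
    have "jumps G g B \<subseteq> F m \<union> {x \<in> carrier G. g \<otimes> x \<in> F m}"
    proof
      fix x assume "x \<in> jumps G g B"
      then have xc: "x \<in> carrier G" and d: "(x \<in> B) \<noteq> (g \<otimes> x \<in> B)" by (auto simp: jumps_def)
      show "x \<in> F m \<union> {x \<in> carrier G. g \<otimes> x \<in> F m}"
      proof (cases "x \<in> B")
        case True
        then obtain k where k: "x \<in> L (2 * k)" by (auto simp: B_def)
        have "2 * k < m"
        proof (rule ccontr)
          assume "\<not> 2 * k < m"
          then have "g \<in> \<Gamma> (2 * k)" using mem m by simp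
          then have "g \<otimes> x \<in> L (2 * k)" using Finv k by (auto simp: L_def)
          then show False using d True by (auto simp: B_def)
        qed
        then show ?thesis using L_F k by blast
      next
        case False
        then obtain k where k: "g \<otimes> x \<in> L (2 * k)" using d by (auto simp: B_def)
        have "2 * k < m"
        proof (rule ccontr)
          assume "\<not> 2 * k < m"
          then have "inv g \<in> \<Gamma> (2 * k)" using mem m sg by (simp add: subgroup.m_inv_closed)
          then have "inv g \<otimes> (g \<otimes> x) \<in> L (2 * k)" using Finv k unfolding L_def by blast
          moreover have "inv g \<otimes> (g \<otimes> x) = x" using g xc by (simp add: m_assoc[symmetric])
          ultimately show False using False by (auto simp: B_def)
        qed
        then show ?thesis using L_F k xc by blast
      qed
    qed
    then show ?thesis using F(1) finite_translate_preimage[OF F(1) g] by (meson finite_UnI finite_subset)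
  qed
  then have "left_commensurated G B"
    using BA Ac unfolding left_commensurated_iff_jumps by blast
  then show ?thesis using i1 i2 unfolding unsplittable_def by blast
qed

text \<open>It remains to find a generating set \<open>T\<close> whose group meets all four pieces in infinite sets, while its
exceptional set is smaller than \<open>A\<close>. If some finitely generated subgroup is infinite, adding four coset
representatives to its generators gives a finite \<open>T\<close>. If the group is uncountable, then so is \<open>A\<close>, and
\<open>T\<close> can be made of countable parts of the pieces. The remaining groups are countable and locally finite,
and in them every infinite commensurated set splits.\<close>

lemma unsplittable_no_four_infinite:
  assumes A: "left_commensurated G A" "unsplittable G A" "infinite A"
    and com: "left_commensurated G P" "left_commensurated G Q"
      "left_commensurated G R" "left_commensurated G S"
    and inf: "infinite P" "infinite Q" "infinite R" "infinite S"
    and disj: "P \<inter> Q = {}" "R \<inter> S = {}" "(P \<union> Q) \<inter> (R \<union> S) = {}"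
  shows False
proof -
  have PQ: "left_commensurated G (P \<union> Q)" using com by (simp add: left_commensurated_Un)
  have sub: "P \<subseteq> carrier G" "Q \<subseteq> carrier G" "R \<subseteq> carrier G" "S \<subseteq> carrier G"
    using com by (simp_all add: left_commensurated_subset)
  consider (fg) S0 where "finite S0" "S0 \<subseteq> carrier G" "infinite (generate G S0)"
    | (countable) "countable (carrier G)"
        "\<And>S. finite S \<Longrightarrow> S \<subseteq> carrier G \<Longrightarrow> finite (generate G S)"
    | (uncountable) "uncountable (carrier G)"
    by blast
  then show False
  proof cases
    case fg
    obtain p where p: "p \<in> carrier G" "infinite (P \<inter> (generate G S0 #> p))"
      using infinite_meets_coset_of_fg[OF fg com(1) inf(1)] .
    obtain q where q: "q \<in> carrier G" "infinite (Q \<inter> (generate G S0 #> q))"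
      using infinite_meets_coset_of_fg[OF fg com(2) inf(2)] .
    obtain r where r: "r \<in> carrier G" "infinite (R \<inter> (generate G S0 #> r))"
      using infinite_meets_coset_of_fg[OF fg com(3) inf(3)] .
    obtain s where s: "s \<in> carrier G" "infinite (S \<inter> (generate G S0 #> s))"
      using infinite_meets_coset_of_fg[OF fg com(4) inf(4)] .
    define T0 where "T0 = S0 \<union> {p, q, r, s}"
    define T where "T = T0 \<union> (\<lambda>t. inv t) ` T0"
    have T0: "T0 \<subseteq> carrier G" using fg p q r s by (auto simp: T0_def)
    have T: "T \<subseteq> carrier G" "\<And>t. t \<in> T \<Longrightarrow> inv t \<in> T" using T0 by (auto simp: T_def subset_iff)
    have gen: "generate G S0 #> y \<subseteq> generate G T" if "y \<in> {p, q, r, s}" for y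
    proof -
      have "generate G S0 \<subseteq> generate G T" by (rule mono_generate) (auto simp: T_def T0_def)
      moreover have "y \<in> generate G T" using that by (auto simp: T_def T0_def intro: generate.incl)
      ultimately show ?thesis by (auto simp: r_coset_def intro: generate.eng)
    qed
    have big: "infinite (generate G T \<inter> X)"
      if "infinite (X \<inter> (generate G S0 #> y))" "y \<in> {p, q, r, s}" for X y
    proof -
      have "X \<inter> (generate G S0 #> y) \<subseteq> generate G T \<inter> X" using gen[OF that(2)] by blast
      then show ?thesis using that(1) finite_subset by blast
    qed
    have "A \<subseteq> exceptional T A (P \<union> Q)"
      by (rule unsplittable_no_four_pieces[OF A(1,2) com disj T
          big[OF p(2)] big[OF q(2)] big[OF r(2)] big[OF s(2)]]) auto
    moreover have "finite T" using fg by (simp add: T_def T0_def)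
    then have "finite (exceptional T A (P \<union> Q))"
      unfolding exceptional_def
      using finite_exceptional_piece[OF A(1) PQ] T(1) by (intro finite_UN_I) blast+
    ultimately show False using A(3) finite_subset by blast
  next
    case countable
    then show False using locally_finite_countable_splits A by blast
  next
    case uncountable
    obtain P' Q' R' S' where pieces:
      "P' \<subseteq> P" "countable P'" "infinite P'" "Q' \<subseteq> Q" "countable Q'" "infinite Q'"
      "R' \<subseteq> R" "countable R'" "infinite R'" "S' \<subseteq> S" "countable S'" "infinite S'"
      using infinite_countable_subset'[OF inf(1)] infinite_countable_subset'[OF inf(2)]
        infinite_countable_subset'[OF inf(3)] infinite_countable_subset'[OF inf(4)] by metis
    define T0 where "T0 = P' \<union> Q' \<union> R' \<union> S'"
    define T where "T = T0 \<union> (\<lambda>t. inv t) ` T0"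
    have T0: "T0 \<subseteq> carrier G" using sub pieces by (auto simp: T0_def)
    have T: "T \<subseteq> carrier G" "\<And>t. t \<in> T \<Longrightarrow> inv t \<in> T" using T0 by (auto simp: T_def subset_iff)
    have big: "infinite (generate G T \<inter> X)" if "X' \<subseteq> X" "infinite X'" "X' \<subseteq> T0" for X X'
    proof -
      have "X' \<subseteq> generate G T \<inter> X" using that by (auto simp: T_def intro: generate.incl)
      then show ?thesis using that(2) finite_subset by blast
    qed
    have "A \<subseteq> exceptional T A (P \<union> Q)"
      by (rule unsplittable_no_four_pieces[OF A(1,2) com disj T
          big[OF pieces(1,3)] big[OF pieces(4,6)] big[OF pieces(7,9)] big[OF pieces(10,12)]])
        (auto simp: T0_def)
    moreover have "countable T" using pieces by (simp add: T_def T0_def)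
    then have "countable (exceptional T A (P \<union> Q))"
      unfolding exceptional_def
      using finite_exceptional_piece[OF A(1) PQ] T(1)
      by (intro countable_UN) (blast intro: countable_finite)+
    moreover have "uncountable A"
      using uncountable A(1,3) by (rule infinite_left_commensurated_uncountable)
    ultimately show False using countable_subset by blast
  qed
qed

section \<open>The end algebra of an infinitely-ended group is atomless\<close>

lemma in_carrier_end_algebra_iff:
  "K \<in> carrier (end_algebra G) \<longleftrightarrow> (\<exists>A. left_commensurated G A \<and> K = end_class G A)"
  by (auto simp: end_algebra_def quotient_def end_class_def)

lemma end_class_eq_iff:
  assumes "left_commensurated G A" "left_commensurated G B"
  shows "end_class G A = end_class G B \<longleftrightarrow> finite (sym_diff A B)"
  unfolding end_class_def
proof
  assume "almost_equal_rel G `` {A} = almost_equal_rel G `` {B}"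
  moreover have "A \<in> almost_equal_rel G `` {A}" using assms by (simp add: almost_equal_rel_def)
  ultimately have "A \<in> almost_equal_rel G `` {B}" by simp
  then show "finite (sym_diff A B)" by (simp add: almost_equal_rel_def)
next
  assume f: "finite (sym_diff A B)"
  have "finite (sym_diff A C) \<longleftrightarrow> finite (sym_diff B C)" for C
  proof -
    have "sym_diff A C \<subseteq> sym_diff A B \<union> sym_diff B C" "sym_diff B C \<subseteq> sym_diff A B \<union> sym_diff A C"
      by blast+
    then show ?thesis using f by (meson finite_UnI finite_subset)
  qed
  then show "almost_equal_rel G `` {A} = almost_equal_rel G `` {B}"
    using assms by (auto simp: almost_equal_rel_def)
qed

text \<open>A commensurated set meets each member of the cover, up to a finite error, in everything or in
nothing, so the members in which it is negligible determine its class.\<close>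

lemma finitely_many_classes_of_unsplittable_cover:
  assumes "finite \<B>" "\<Union>\<B> = carrier G" "\<And>B. B \<in> \<B> \<Longrightarrow> unsplittable G B"
  shows "\<not> infinitely_ended G"
proof -
  let ?f = "\<lambda>X. {B \<in> \<B>. finite (B \<inter> X)}"
  let ?c = "end_class G"
  have same: "?c X = ?c Y"
    if X: "left_commensurated G X" and Y: "left_commensurated G Y" and eq: "?f X = ?f Y" for X Y
  proof -
    have "finite (B \<inter> sym_diff X Y)" if B: "B \<in> \<B>" for B
    proof (cases "finite (B \<inter> X)")
      case True
      then have "finite (B \<inter> Y)" using eq B by blast
      with True have "finite (B \<inter> X \<union> B \<inter> Y)" by blast
      then show ?thesis by (rule rev_finite_subset) blast
    next
      case False
      then have "infinite (B \<inter> Y)" using eq B by blast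
      with False have "finite (B - X)" "finite (B - Y)"
        using assms(3)[OF B] X Y unfolding unsplittable_def by blast+
      then have "finite ((B - X) \<union> (B - Y))" by blast
      then show ?thesis by (rule rev_finite_subset) blast
    qed
    then have "finite (\<Union>B\<in>\<B>. B \<inter> sym_diff X Y)" using assms(1) by blast
    moreover have "sym_diff X Y \<subseteq> (\<Union>B\<in>\<B>. B \<inter> sym_diff X Y)"
      using left_commensurated_subset[OF X] left_commensurated_subset[OF Y] assms(2) by blast
    ultimately have "finite (sym_diff X Y)" by (rule rev_finite_subset)
    then show ?thesis using end_class_eq_iff[OF X Y] by blast
  qed
  define g where "g F = ?c (SOME X. left_commensurated G X \<and> ?f X = F)" for F
  have "carrier (end_algebra G) \<subseteq> g ` Pow \<B>"
  proof
    fix K assume "K \<in> carrier (end_algebra G)"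
    then obtain X where X: "left_commensurated G X" "K = ?c X"
      using in_carrier_end_algebra_iff by blast
    define Y where "Y = (SOME Y. left_commensurated G Y \<and> ?f Y = ?f X)"
    have "left_commensurated G Y \<and> ?f Y = ?f X"
      unfolding Y_def by (rule someI[of _ X]) (use X in auto)
    then have "K = ?c Y" using X same by blast
    then have "K = g (?f X)" by (simp add: g_def Y_def)
    then show "K \<in> g ` Pow \<B>" by blast
  qed
  then have "finite (carrier (end_algebra G))"
    using assms(1) by (meson finite_Pow_iff finite_imageI finite_subset)
  then show ?thesis by (simp add: infinitely_ended_def)
qed

text \<open>An atom together with an infinite end algebra yields four disjoint infinite sets. Three
unsplittable sets cannot cover the group, so the complement of \<open>A\<close> splits into some \<open>C\<close> and \<open>D\<close>, one of which
splits further; its two parts, the other one and \<open>A\<close> are the four sets.\<close>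

theorem infinitely_ended_no_atom:
  assumes inf: "infinitely_ended G" and A: "left_commensurated G A" "infinite A"
  shows "\<not> unsplittable G A"
proof
  assume u: "unsplittable G A"
  have Ac: "A \<subseteq> carrier G" using A(1) by (rule left_commensurated_subset)
  let ?A' = "carrier G - A"
  have "\<not> unsplittable G ?A'"
    using finitely_many_classes_of_unsplittable_cover[of "{A, ?A'}"] inf u Ac by auto
  then obtain X where X: "left_commensurated G X" "infinite (?A' \<inter> X)" "infinite (?A' - X)"
    unfolding unsplittable_def by blast
  define C D where "C = ?A' \<inter> X" and "D = ?A' - X"
  have CD: "left_commensurated G C" "left_commensurated G D"
    unfolding C_def D_def using A(1) X(1)
    by (simp_all add: left_commensurated_compl left_commensurated_diff left_commensurated_Int[OF is_group])
  \<comment> \<open>The parts of a splitting of \<open>K\<close>, with \<open>A\<close> and \<open>M\<close>, would be four disjoint infinite sets.\<close>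
  have no: "unsplittable G K"
    if K: "left_commensurated G K" "A \<inter> K = {}" and M: "left_commensurated G M" "infinite M" "M \<inter> (A \<union> K) = {}"
    for K M
    unfolding unsplittable_def
  proof (intro allI impI)
    fix Y assume Y: "left_commensurated G Y"
    show "finite (K \<inter> Y) \<or> finite (K - Y)"
    proof (rule ccontr)
      assume "\<not> (finite (K \<inter> Y) \<or> finite (K - Y))"
      then show False
        using unsplittable_no_four_infinite[OF A(1) u A(2), of "K \<inter> Y" "K - Y" A M]
          K M A Y left_commensurated_Int[OF is_group K(1) Y] left_commensurated_diff[OF K(1) Y] by blast
    qed
  qed
  have "unsplittable G C"
    by (rule no[OF CD(1) _ CD(2)]) (use X in \<open>auto simp: C_def D_def\<close>)
  moreover have "unsplittable G D"
    by (rule no[OF CD(2) _ CD(1)]) (use X in \<open>auto simp: C_def D_def\<close>)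
  moreover have "\<Union>{A, C, D} = carrier G" using Ac by (auto simp: C_def D_def)
  ultimately show False
    using finitely_many_classes_of_unsplittable_cover[of "{A, C, D}"] inf u by auto
qed

end

section \<open>Ends as ultrafilters\<close>

lemma order_filter_lower:
  assumes "order_filter L F" "x \<in> F" "y \<in> F"
  obtains z where "z \<in> F" "z \<sqsubseteq>\<^bsub>L\<^esub> x" "z \<sqsubseteq>\<^bsub>L\<^esub> y"
proof -
  have "\<forall>x\<in>F. \<forall>y\<in>F. \<exists>z\<in>F. z \<sqsubseteq>\<^bsub>L\<^esub> x \<and> z \<sqsubseteq>\<^bsub>L\<^esub> y"
    using assms(1) unfolding order_filter_def by (elim conjE)
  then show ?thesis using assms(2,3) that by blast
qed

lemma order_filter_up:
  assumes "order_filter L F" "x \<in> F" "y \<in> carrier L" "x \<sqsubseteq>\<^bsub>L\<^esub> y"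
  shows "y \<in> F"
  using assms by (simp add: order_filter_def)

lemma order_filter_subset: "order_filter L F \<Longrightarrow> F \<subseteq> carrier L"
  by (simp add: order_filter_def)

text \<open>Over an order with a least element, a filter is proper exactly when it omits that element, and this
property passes to unions of chains; so Zorn's lemma applies.\<close>

lemma order_filter_extends_to_ultrafilter:
  assumes bot: "b \<in> carrier L" "\<And>y. y \<in> carrier L \<Longrightarrow> b \<sqsubseteq>\<^bsub>L\<^esub> y"
    and F: "order_filter L F" "b \<notin> F"
  obtains U where "order_ultrafilter L U" "F \<subseteq> U"
proof -
  let ?\<A> = "{F'. order_filter L F' \<and> b \<notin> F' \<and> F \<subseteq> F'}"
  have "\<exists>M\<in>?\<A>. \<forall>X\<in>?\<A>. M \<subseteq> X \<longrightarrow> X = M"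
  proof (rule subset_Zorn_nonempty)
    show "?\<A> \<noteq> {}" using F by blast
    fix \<C> assume ne: "\<C> \<noteq> {}" and ch: "subset.chain ?\<A> \<C>"
    have mem: "order_filter L X \<and> b \<notin> X \<and> F \<subseteq> X" if "X \<in> \<C>" for X
      using ch that by (auto simp: subset_chain_def)
    have "order_filter L (\<Union>\<C>)"
      unfolding order_filter_def
    proof (intro conjI ballI impI)
      show "\<Union>\<C> \<subseteq> carrier L" using mem order_filter_subset by blast
      show "\<Union>\<C> \<noteq> {}" using ne mem by (fastforce simp: order_filter_def)
      show "y \<in> \<Union>\<C>" if "x \<in> \<Union>\<C>" "y \<in> carrier L" "x \<sqsubseteq>\<^bsub>L\<^esub> y" for x y
        using that mem order_filter_up by (metis UnionE UnionI)
      show "\<exists>z\<in>\<Union>\<C>. z \<sqsubseteq>\<^bsub>L\<^esub> x \<and> z \<sqsubseteq>\<^bsub>L\<^esub> y" if xy: "x \<in> \<Union>\<C>" "y \<in> \<Union>\<C>" for x y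
      proof -
        obtain X Y where XY: "X \<in> \<C>" "x \<in> X" "Y \<in> \<C>" "y \<in> Y" using xy by blast
        then have "X \<subseteq> Y \<or> Y \<subseteq> X" using ch by (auto simp: subset_chain_def)
        then obtain Z where "Z \<in> \<C>" "x \<in> Z" "y \<in> Z" using XY by blast
        then show ?thesis using mem[of Z] order_filter_lower[of L Z x y] by blast
      qed
    qed
    then show "\<Union>\<C> \<in> ?\<A>" using ne mem by blast
  qed
  then obtain U where mem: "U \<in> ?\<A>" and maximal: "\<forall>X\<in>?\<A>. U \<subseteq> X \<longrightarrow> X = U" ..
  have U: "order_filter L U" "b \<notin> U" "F \<subseteq> U" using mem by simp_all
  have max: "X = U" if "order_filter L X" "b \<notin> X" "F \<subseteq> X" "U \<subseteq> X" for X
    using maximal that by simp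
  have "X = U" if X: "order_filter L X" "X \<noteq> carrier L" "U \<subseteq> X" for X
  proof (rule max)
    show "b \<notin> X" using X(2) order_filter_subset[OF X(1)] order_filter_up[OF X(1)] bot(2) by blast
  qed (use X U in auto)
  then have "order_ultrafilter L U" using U bot(1) by (auto simp: order_ultrafilter_def)
  then show ?thesis using U by (intro that)
qed

text \<open>The clopen subset of the space of ends that Stone duality attaches to the class of \<open>A\<close>.\<close>

definition ends_of :: "('a, 'b) monoid_scheme \<Rightarrow> 'a set \<Rightarrow> 'a set set set set" where
  "ends_of G A = {U. order_ultrafilter (end_algebra G) U \<and> end_class G A \<in> U}"

context group
begin

lemma end_class_le_iff:
  assumes "left_commensurated G A" "left_commensurated G B"
  shows "end_class G A \<sqsubseteq>\<^bsub>end_algebra G\<^esub> end_class G B \<longleftrightarrow> finite (A - B)"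
  using end_algebra_le_iff[OF is_group assms] by (simp add: end_class_def)

lemma order_filter_upward:
  assumes "order_filter (end_algebra G) F" "end_class G A \<in> F"
    and "left_commensurated G A" "left_commensurated G B" "finite (A - B)"
  shows "end_class G B \<in> F"
proof -
  have "end_class G A \<sqsubseteq>\<^bsub>end_algebra G\<^esub> end_class G B" using assms end_class_le_iff by simp
  moreover have "end_class G B \<in> carrier (end_algebra G)"
    using assms(4) in_carrier_end_algebra_iff by blast
  ultimately show ?thesis using order_filter_up[OF assms(1,2)] by blast
qed

lemma order_filter_Int:
  assumes F: "order_filter (end_algebra G) F" "end_class G A \<in> F" "end_class G B \<in> F"
    and A: "left_commensurated G A" and B: "left_commensurated G B"
  shows "end_class G (A \<inter> B) \<in> F"
proof -
  obtain z where z: "z \<in> F" "z \<sqsubseteq>\<^bsub>end_algebra G\<^esub> end_class G A" "z \<sqsubseteq>\<^bsub>end_algebra G\<^esub> end_class G B"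
    using order_filter_lower[OF F] .
  then have "z \<in> carrier (end_algebra G)" using order_filter_subset[OF F(1)] by blast
  then obtain C where C: "left_commensurated G C" "z = end_class G C"
    using in_carrier_end_algebra_iff by blast
  then have "finite (C - A)" "finite (C - B)" using z end_class_le_iff A B by simp_all
  then have "finite (C - A \<inter> B)" by (simp add: Diff_Int)
  then show ?thesis
    using order_filter_upward[OF F(1)] C z(1) left_commensurated_Int[OF is_group A B] by blast
qed

lemma in_ends_ofD:
  assumes "U \<in> ends_of G A" and A: "left_commensurated G A"
  shows "infinite A"
proof
  assume fin: "finite A"
  have U: "order_filter (end_algebra G) U" "U \<noteq> carrier (end_algebra G)" "end_class G A \<in> U"
    using assms by (simp_all add: ends_of_def order_ultrafilter_def)
  have "K \<in> U" if K: "K \<in> carrier (end_algebra G)" for K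
  proof -
    obtain B where "left_commensurated G B" "K = end_class G B"
      using K in_carrier_end_algebra_iff by blast
    then show ?thesis using order_filter_upward[OF U(1,3) A, of B] fin by simp
  qed
  then show False using U(2) order_filter_subset[OF U(1)] by blast
qed

lemma ends_of_empty: "ends_of G {} = {}"
  using in_ends_ofD[of _ "{}"] left_commensurated_finite[of "{}"] by auto

lemma ends_of_mono:
  assumes AB: "left_commensurated G A" "left_commensurated G B" "A \<subseteq> B"
  shows "ends_of G A \<subseteq> ends_of G B"
proof
  fix U assume "U \<in> ends_of G A"
  then have U: "order_ultrafilter (end_algebra G) U" "end_class G A \<in> U"
    by (simp_all add: ends_of_def)
  then have "order_filter (end_algebra G) U" by (simp add: order_ultrafilter_def)
  then have "end_class G B \<in> U" 
    using U(2) AB(1,2) by (rule order_filter_upward) (use AB(3) in \<open>simp add: Diff_eq_empty_iff[THEN iffD2]\<close>)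
  then show "U \<in> ends_of G B" using U(1) by (simp add: ends_of_def)
qed

lemma ends_of_Int:
  assumes "left_commensurated G A" "left_commensurated G B"
  shows "ends_of G (A \<inter> B) = ends_of G A \<inter> ends_of G B"
proof
  have "left_commensurated G (A \<inter> B)" using assms left_commensurated_Int[OF is_group] by blast
  then show "ends_of G (A \<inter> B) \<subseteq> ends_of G A \<inter> ends_of G B"
    using assms ends_of_mono by (meson Int_greatest Int_lower1 Int_lower2)
  show "ends_of G A \<inter> ends_of G B \<subseteq> ends_of G (A \<inter> B)"
  proof
    fix U assume "U \<in> ends_of G A \<inter> ends_of G B"
    then have U: "order_ultrafilter (end_algebra G) U" "end_class G A \<in> U" "end_class G B \<in> U"
      by (simp_all add: ends_of_def)
    then have "order_filter (end_algebra G) U" by (simp add: order_ultrafilter_def)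
    then have "end_class G (A \<inter> B) \<in> U" using U(2,3) assms by (rule order_filter_Int)
    then show "U \<in> ends_of G (A \<inter> B)" using U(1) by (simp add: ends_of_def)
  qed
qed

text \<open>The classes above members of the filter base form a filter, which is proper because no member of the
base is finite, and every proper filter extends to an ultrafilter.\<close>

lemma exists_end_over_filter_base:
  assumes ne: "\<F> \<noteq> {}"
    and com: "\<And>A. A \<in> \<F> \<Longrightarrow> left_commensurated G A"
    and inf: "\<And>A. A \<in> \<F> \<Longrightarrow> infinite A"
    and int: "\<And>A B. A \<in> \<F> \<Longrightarrow> B \<in> \<F> \<Longrightarrow> A \<inter> B \<in> \<F>"
  shows "\<exists>U. \<forall>A\<in>\<F>. U \<in> ends_of G A"
proof -
  let ?L = "end_algebra G"
  define F where "F = {end_class G C | C. left_commensurated G C \<and> (\<exists>A\<in>\<F>. finite (A - C))}"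
  have empty: "left_commensurated G {}" by (simp add: left_commensurated_finite)
  have filter: "order_filter ?L F"
    unfolding order_filter_def
  proof (intro conjI ballI impI)
    show "F \<subseteq> carrier ?L" by (auto simp: F_def in_carrier_end_algebra_iff)
    show "F \<noteq> {}" using ne com by (fastforce simp: F_def)
  next
    fix x y assume x: "x \<in> F" and y: "y \<in> carrier ?L" and le: "x \<sqsubseteq>\<^bsub>?L\<^esub> y"
    obtain C A where C: "left_commensurated G C" "x = end_class G C" "A \<in> \<F>" "finite (A - C)"
      using x by (auto simp: F_def)
    obtain D where D: "left_commensurated G D" "y = end_class G D"
      using y in_carrier_end_algebra_iff by blast
    have "finite ((A - C) \<union> (C - D))" using le C D end_class_le_iff by simp
    then have "finite (A - D)" by (rule rev_finite_subset) blast
    then show "y \<in> F" using C D by (auto simp: F_def)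
  next
    fix x y assume x: "x \<in> F" and y: "y \<in> F"
    obtain C A where C: "left_commensurated G C" "x = end_class G C" "A \<in> \<F>" "finite (A - C)"
      using x by (auto simp: F_def)
    obtain D B where D: "left_commensurated G D" "y = end_class G D" "B \<in> \<F>" "finite (B - D)"
      using y by (auto simp: F_def)
    have AB: "A \<inter> B \<in> \<F>" "left_commensurated G (A \<inter> B)" using C D int com by blast+
    have "finite (A \<inter> B - C)" "finite (A \<inter> B - D)"
      using C(4) D(4) by (auto elim: rev_finite_subset)
    then have "end_class G (A \<inter> B) \<sqsubseteq>\<^bsub>?L\<^esub> x" "end_class G (A \<inter> B) \<sqsubseteq>\<^bsub>?L\<^esub> y"
      using end_class_le_iff[OF AB(2)] C(1,2) D(1,2) by simp_all
    moreover have "end_class G (A \<inter> B) \<in> F"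
      unfolding F_def using AB by (intro CollectI exI[of _ "A \<inter> B"] conjI bexI[of _ "A \<inter> B"]) auto
    ultimately show "\<exists>z\<in>F. z \<sqsubseteq>\<^bsub>?L\<^esub> x \<and> z \<sqsubseteq>\<^bsub>?L\<^esub> y" by blast
  qed
  have "end_class G {} \<notin> F"
  proof
    assume "end_class G {} \<in> F"
    then obtain C A where C: "left_commensurated G C" "end_class G {} = end_class G C"
      "A \<in> \<F>" "finite (A - C)" by (auto simp: F_def)
    then have "finite C" using end_class_eq_iff[OF empty C(1)] by simp
    then have "finite A" using C(4) by simp
    then show False using inf C(3) by blast
  qed
  moreover have "end_class G {} \<sqsubseteq>\<^bsub>?L\<^esub> y" if "y \<in> carrier ?L" for y
    using that end_class_le_iff[OF empty] in_carrier_end_algebra_iff by auto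
  moreover have "end_class G {} \<in> carrier ?L" using empty in_carrier_end_algebra_iff by blast
  ultimately obtain U where U: "order_ultrafilter ?L U" "F \<subseteq> U"
    using order_filter_extends_to_ultrafilter[OF _ _ filter] by blast
  have "end_class G A \<in> F" if A: "A \<in> \<F>" for A
    unfolding F_def using A com[OF A] by (intro CollectI exI[of _ A] conjI bexI[of _ A]) auto
  then show ?thesis using U by (auto simp: ends_of_def)
qed

text \<open>Ultrafilters are prime. If \<open>A\<close> met every set of \<open>U\<close> in an infinite set, some end would contain both
\<open>U\<close> and \<open>A\<close>, and maximality would put \<open>A\<close> into \<open>U\<close>. So \<open>A\<close> is almost disjoint from some set of \<open>U\<close>, and
the complement of \<open>A\<close> almost contains that set.\<close>

lemma ends_of_compl:
  assumes A: "left_commensurated G A"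
  shows "ends_of G (carrier G - A) = topspace (ends_space G) - ends_of G A"
proof
  have cA: "left_commensurated G (carrier G - A)" using A by (rule left_commensurated_compl)
  have "ends_of G (carrier G - A) \<inter> ends_of G A = ends_of G {}"
    using ends_of_Int[OF cA A] by (simp add: Int_commute[of "carrier G - A"])
  then show "ends_of G (carrier G - A) \<subseteq> topspace (ends_space G) - ends_of G A"
    using ends_of_empty by (auto simp: ends_space_def topspace_stone_dual ends_of_def)
  show "topspace (ends_space G) - ends_of G A \<subseteq> ends_of G (carrier G - A)"
  proof
    fix U assume U: "U \<in> topspace (ends_space G) - ends_of G A"
    then have ultra: "order_ultrafilter (end_algebra G) U" and nA: "end_class G A \<notin> U"
      by (simp_all add: ends_space_def topspace_stone_dual ends_of_def)
    then have filt: "order_filter (end_algebra G) U" by (simp add: order_ultrafilter_def)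
    then obtain K0 where K0: "K0 \<in> U" by (auto simp: order_filter_def)
    then have "K0 \<in> carrier (end_algebra G)" using order_filter_subset[OF filt] by blast
    then obtain B0 where B0: "left_commensurated G B0" "end_class G B0 \<in> U"
      using K0 in_carrier_end_algebra_iff by auto
    let ?\<F> = "{B \<inter> A | B. left_commensurated G B \<and> end_class G B \<in> U}"
    have "\<exists>B. left_commensurated G B \<and> end_class G B \<in> U \<and> finite (B \<inter> A)"
    proof (rule ccontr)
      assume neg: "\<not> ?thesis"
      have "\<exists>W. \<forall>B\<in>?\<F>. W \<in> ends_of G B"
      proof (rule exists_end_over_filter_base)
        show "?\<F> \<noteq> {}" using B0 by blast
        show "left_commensurated G B" if "B \<in> ?\<F>" for B
          using that A left_commensurated_Int[OF is_group] by blast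
        show "infinite B" if "B \<in> ?\<F>" for B using that neg by blast
        show "B \<inter> C \<in> ?\<F>" if BC: "B \<in> ?\<F>" "C \<in> ?\<F>" for B C
        proof -
          obtain B' C' where BC': "B = B' \<inter> A" "left_commensurated G B'" "end_class G B' \<in> U"
              "C = C' \<inter> A" "left_commensurated G C'" "end_class G C' \<in> U"
            using BC by blast
          then have "left_commensurated G (B' \<inter> C')" "end_class G (B' \<inter> C') \<in> U"
            using left_commensurated_Int[OF is_group] order_filter_Int[OF filt] by blast+
          moreover have "B \<inter> C = (B' \<inter> C') \<inter> A" using BC' by blast
          ultimately show ?thesis by blast
        qed
      qed
      then obtain W where W: "\<And>B. left_commensurated G B \<Longrightarrow> end_class G B \<in> U \<Longrightarrow> W \<in> ends_of G (B \<inter> A)"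
        by blast
      have WBA: "W \<in> ends_of G B \<and> W \<in> ends_of G A"
        if "left_commensurated G B" "end_class G B \<in> U" for B
        using W[OF that] ends_of_Int[OF that(1) A] by blast
      have UW: "K \<in> W" if "K \<in> U" for K
      proof -
        have "K \<in> carrier (end_algebra G)" using that order_filter_subset[OF filt] by blast
        then obtain B where "left_commensurated G B" "K = end_class G B"
          using in_carrier_end_algebra_iff by blast
        then show ?thesis using WBA that by (simp add: ends_of_def)
      qed
      have "W \<in> ends_of G A" using WBA[OF B0] by blast
      then have "order_ultrafilter (end_algebra G) W" "end_class G A \<in> W"
        by (simp_all add: ends_of_def)
      then have "W = U" using ultra UW unfolding order_ultrafilter_def by blast
      then show False using nA \<open>end_class G A \<in> W\<close> by blast
    qed
    then obtain B where B: "left_commensurated G B" "end_class G B \<in> U" "finite (B \<inter> A)" by blast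
    have "B - (carrier G - A) \<subseteq> B \<inter> A" using left_commensurated_subset[OF B(1)] by blast
    then have "finite (B - (carrier G - A))" using B(3) by (rule finite_subset)
    then have "end_class G (carrier G - A) \<in> U" using order_filter_upward[OF filt B(2,1) cA] by blast
    then show "U \<in> ends_of G (carrier G - A)" using ultra by (simp add: ends_of_def)
  qed
qed

lemma ends_space_generators:
  "ends_space G = topology_generated_by (ends_of G ` Collect (left_commensurated G))"
proof -
  have "{{U. order_ultrafilter (end_algebra G) U \<and> a \<in> U} | a. a \<in> carrier (end_algebra G)}
    = ends_of G ` Collect (left_commensurated G)"
    by (auto simp: in_carrier_end_algebra_iff ends_of_def)
  then show ?thesis by (simp add: ends_space_def stone_dual_def)
qed

lemma openin_ends_of: "left_commensurated G A \<Longrightarrow> openin (ends_space G) (ends_of G A)"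
  by (auto simp: ends_space_generators intro: topology_generated_by_Basis)

lemma closedin_ends_of:
  assumes "left_commensurated G A"
  shows "closedin (ends_space G) (ends_of G A)"
  using openin_ends_of[OF left_commensurated_compl[OF assms]] openin_subset[OF openin_ends_of[OF assms]]
  by (simp add: closedin_def ends_of_compl[OF assms])

text \<open>The generating sets are closed under finite intersections, so they form a basis and not only a
subbasis.\<close>

lemma ends_of_basis:
  assumes "openin (ends_space G) W" "U \<in> W"
  shows "\<exists>A. left_commensurated G A \<and> U \<in> ends_of G A \<and> ends_of G A \<subseteq> W"
proof -
  have "generate_topology_on (ends_of G ` Collect (left_commensurated G)) W"
    using assms(1) unfolding ends_space_generators by (rule openin_topology_generated_by)
  then show ?thesis using assms(2)
  proof (induction arbitrary: U)
    case Empty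
    then show ?case by simp
  next
    case (Int V W)
    then obtain A B where "left_commensurated G A" "U \<in> ends_of G A" "ends_of G A \<subseteq> V"
      "left_commensurated G B" "U \<in> ends_of G B" "ends_of G B \<subseteq> W" by (meson IntE)
    then show ?case
      using ends_of_Int left_commensurated_Int[OF is_group] by (intro exI[of _ "A \<inter> B"]) auto
  next
    case (UN K)
    then obtain k A where "k \<in> K" "left_commensurated G A" "U \<in> ends_of G A" "ends_of G A \<subseteq> k"
      by (meson UnionE)
    then show ?case by blast
  next
    case (Basis s)
    then show ?case by blast
  qed
qed

text \<open>Replace an open cover by the basic sets that lie inside its members. If no finitely many of
the corresponding subsets of the group covered it up to a finite set, the complements of their
finite unions would form a filter base, and an end over it would be missed by the cover.\<close>

lemma compact_ends_space: "compact_space (ends_space G)"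
  unfolding compact_space_alt
proof (intro allI impI, elim conjE)
  fix \<U> assume op: "\<forall>W\<in>\<U>. openin (ends_space G) W" and cov: "topspace (ends_space G) \<subseteq> \<Union>\<U>"
  define \<K> where "\<K> = {A. left_commensurated G A \<and> (\<exists>W\<in>\<U>. ends_of G A \<subseteq> W)}"
  have K: "\<exists>A\<in>\<K>. U \<in> ends_of G A" if U: "U \<in> topspace (ends_space G)" for U
  proof -
    obtain W where "W \<in> \<U>" "U \<in> W" using cov U by blast
    then show ?thesis using ends_of_basis[of W U] op unfolding \<K>_def by blast
  qed
  have compl: "left_commensurated G (carrier G - \<Union>\<L>) \<and>
      ends_of G (carrier G - \<Union>\<L>) = topspace (ends_space G) - \<Union>(ends_of G ` \<L>)"
    if "finite \<L>" "\<L> \<subseteq> \<K>" for \<L>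
    using that
  proof (induction rule: finite_induct)
    case empty
    show ?case
      using ends_of_compl[of "{}"] ends_of_empty left_commensurated_carrier
      by (simp add: left_commensurated_finite)
  next
    case (insert A \<L>)
    have A: "left_commensurated G (carrier G - A)" "left_commensurated G A"
      using insert by (auto simp: \<K>_def left_commensurated_compl)
    have L: "left_commensurated G (carrier G - \<Union>\<L>)"
      "ends_of G (carrier G - \<Union>\<L>) = topspace (ends_space G) - \<Union>(ends_of G ` \<L>)"
      using insert by simp_all
    have eq: "carrier G - \<Union>(insert A \<L>) = (carrier G - A) \<inter> (carrier G - \<Union>\<L>)" by blast
    show ?case
      unfolding eq ends_of_Int[OF A(1) L(1)] ends_of_compl[OF A(2)] L(2)
      using left_commensurated_Int[OF is_group A(1) L(1)] by auto
  qed
  have "\<exists>\<K>'. finite \<K>' \<and> \<K>' \<subseteq> \<K> \<and> finite (carrier G - \<Union>\<K>')"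
  proof (rule ccontr)
    assume neg: "\<not> ?thesis"
    let ?\<F> = "{carrier G - \<Union>\<K>' | \<K>'. finite \<K>' \<and> \<K>' \<subseteq> \<K>}"
    have "\<exists>U. \<forall>A\<in>?\<F>. U \<in> ends_of G A"
    proof (rule exists_end_over_filter_base)
      show "?\<F> \<noteq> {}" by blast
      show "left_commensurated G A" if "A \<in> ?\<F>" for A using that compl by blast
      show "infinite A" if "A \<in> ?\<F>" for A using that neg by blast
      show "A \<inter> B \<in> ?\<F>" if AB: "A \<in> ?\<F>" "B \<in> ?\<F>" for A B
      proof -
        obtain \<K>1 \<K>2 where "A = carrier G - \<Union>\<K>1" "finite \<K>1" "\<K>1 \<subseteq> \<K>"
          "B = carrier G - \<Union>\<K>2" "finite \<K>2" "\<K>2 \<subseteq> \<K>" using AB by blast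
        then have "A \<inter> B = carrier G - \<Union>(\<K>1 \<union> \<K>2)" "finite (\<K>1 \<union> \<K>2)" "\<K>1 \<union> \<K>2 \<subseteq> \<K>" by auto
        then show ?thesis by blast
      qed
    qed
    then obtain U where U: "\<And>\<K>'. finite \<K>' \<Longrightarrow> \<K>' \<subseteq> \<K> \<Longrightarrow> U \<in> ends_of G (carrier G - \<Union>\<K>')" by blast
    have "U \<in> topspace (ends_space G)"
      using U[of "{}"] by (simp add: ends_of_def ends_space_def topspace_stone_dual)
    then obtain A where "A \<in> \<K>" "U \<in> ends_of G A" using K by blast
    then show False using U[of "{A}"] compl[of "{A}"] by simp
  qed
  then obtain \<K>' where \<K>': "finite \<K>'" "\<K>' \<subseteq> \<K>" "finite (carrier G - \<Union>\<K>')" by blast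
  have "ends_of G (carrier G - \<Union>\<K>') = {}"
    using in_ends_ofD[of _ "carrier G - \<Union>\<K>'"] \<K>' compl by blast
  then have cov': "topspace (ends_space G) \<subseteq> \<Union>(ends_of G ` \<K>')" using compl \<K>' by blast
  have "\<forall>A\<in>\<K>'. \<exists>W. W \<in> \<U> \<and> ends_of G A \<subseteq> W" using \<K>'(2) by (auto simp: \<K>_def)
  from bchoice[OF this] obtain w where w: "\<forall>A\<in>\<K>'. w A \<in> \<U> \<and> ends_of G A \<subseteq> w A" ..
  then have "topspace (ends_space G) \<subseteq> \<Union>(w ` \<K>')" using cov' by blast
  moreover have "finite (w ` \<K>')" "w ` \<K>' \<subseteq> \<U>" using \<K>'(1) w by auto
  ultimately show "\<exists>\<F>. finite \<F> \<and> \<F> \<subseteq> \<U> \<and> topspace (ends_space G) \<subseteq> \<Union>\<F>" by blast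
qed

lemma ends_of_nonempty:
  assumes "left_commensurated G A" "infinite A"
  shows "ends_of G A \<noteq> {}"
  using exists_end_over_filter_base[of "{A}"] assms by auto

text \<open>Take a basic set that contains only the isolated end. A splitting of the corresponding subset of the
group would give two different ends in it, one for each part.\<close>

lemma isolated_end_gives_atom:
  assumes "isolated_point_of (ends_space G) U"
  shows "\<exists>A. left_commensurated G A \<and> infinite A \<and> unsplittable G A"
proof -
  obtain A where A: "left_commensurated G A" "U \<in> ends_of G A" "ends_of G A \<subseteq> {U}"
    using assms ends_of_basis[of "{U}" U] by (auto simp: isolated_point_of_def)
  have "finite (A \<inter> B) \<or> finite (A - B)" if B: "left_commensurated G B" for B
  proof (rule ccontr)
    assume inf: "\<not> ?thesis"
    have com: "left_commensurated G (A \<inter> B)" "left_commensurated G (A - B)"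
      using A(1) B left_commensurated_Int[OF is_group] left_commensurated_diff by blast+
    have "ends_of G (A \<inter> B) \<subseteq> ends_of G A" by (rule ends_of_mono[OF com(1) A(1)]) blast
    moreover have "ends_of G (A - B) \<subseteq> ends_of G A" by (rule ends_of_mono[OF com(2) A(1)]) blast
    ultimately have "U \<in> ends_of G (A \<inter> B)" "U \<in> ends_of G (A - B)"
      using ends_of_nonempty[OF com(1)] ends_of_nonempty[OF com(2)] inf A(3) by blast+
    then have "U \<in> ends_of G ((A \<inter> B) \<inter> (A - B))" using ends_of_Int[OF com] by blast
    moreover have "(A \<inter> B) \<inter> (A - B) = {}" by blast
    ultimately show False using ends_of_empty by simp
  qed
  then show ?thesis using A in_ends_ofD unfolding unsplittable_def by blast
qed

lemma infinitely_ended_infinite_carrier: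
  assumes "infinitely_ended G"
  shows "infinite (carrier G)"
  using finitely_many_classes_of_unsplittable_cover[of "{carrier G}"] assms
  by (auto simp: unsplittable_def)

end

section \<open>A topological characterization of the Cantor space\<close>

text \<open>A set by which to cut \<open>P\<close> into two nonempty parts: the proposed set \<open>C\<close> if it cuts \<open>P\<close>, and otherwise
any member of \<open>\<K>\<close> that does.\<close>

definition splitter :: "'c set set \<Rightarrow> 'c set \<Rightarrow> 'c set \<Rightarrow> 'c set" where
  "splitter \<K> P C =
     (if P \<inter> C \<noteq> {} \<and> P - C \<noteq> {} then C else (SOME Q. Q \<in> \<K> \<and> P \<inter> Q \<noteq> {} \<and> P - Q \<noteq> {}))"

text \<open>The binary tree of clopen sets obtained by cutting the whole space again and again. A branch of the tree is
given by \<open>y\<close>, and the cell at depth \<open>n\<close> depends only on the first \<open>n\<close> values of \<open>y\<close>. Proposing \<open>c n\<close> as the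
cut at depth \<open>n\<close> ensures that every cell below lies inside \<open>c n\<close> or outside it.\<close>

primrec cell :: "'c topology \<Rightarrow> (nat \<Rightarrow> 'c set) \<Rightarrow> (nat \<Rightarrow> bool) \<Rightarrow> nat \<Rightarrow> 'c set" where
  "cell X c y 0 = topspace X"
| "cell X c y (Suc n) =
     (let Q = splitter (range c) (cell X c y n) (c n)
      in if y n then cell X c y n \<inter> Q else cell X c y n - Q)"

text \<open>The branch followed by the point \<open>x\<close>. Deciding each cut by membership of \<open>x\<close> avoids mentioning the code
of the branch, which can then be read off.\<close>

primrec cell_at :: "'c topology \<Rightarrow> (nat \<Rightarrow> 'c set) \<Rightarrow> 'c \<Rightarrow> nat \<Rightarrow> 'c set" where
  "cell_at X c x 0 = topspace X"
| "cell_at X c x (Suc n) =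
     (let Q = splitter (range c) (cell_at X c x n) (c n)
      in if x \<in> Q then cell_at X c x n \<inter> Q else cell_at X c x n - Q)"

text \<open>Brouwer's characterization, with the countable basis of clopen sets replaced by a countable
separating family of clopen sets. The absence of isolated points makes every nonempty clopen set cuttable, so all
branches of the tree consist of nonempty cells. Sending a point to the code of its branch is
continuous because cells are open, injective because the family separates points, and surjective
because compactness puts a point into every branch.\<close>

theorem homeomorphic_cantor_space:
  fixes X :: "'c topology" and c :: "nat \<Rightarrow> 'c set"
  assumes comp: "compact_space X" and ne: "topspace X \<noteq> {}"
    and perfect: "\<nexists>x. isolated_point_of X x"
    and clop: "\<And>n. openin X (c n)" "\<And>n. closedin X (c n)"
    and sep: "\<And>x y. x \<in> topspace X \<Longrightarrow> y \<in> topspace X \<Longrightarrow> x \<noteq> y \<Longrightarrow> \<exists>n. x \<in> c n \<and> y \<notin> c n"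
  shows "X homeomorphic_space cantor_space"
proof -
  let ?sp = "splitter (range c)"
  have split: "?sp P C \<in> range c \<and> P \<inter> ?sp P C \<noteq> {} \<and> P - ?sp P C \<noteq> {}"
    if P: "openin X P" "P \<noteq> {}" and C: "C \<in> range c" for P C
  proof (cases "P \<inter> C \<noteq> {} \<and> P - C \<noteq> {}")
    case True
    then show ?thesis using C by (simp add: splitter_def)
  next
    case False
    obtain x where x: "x \<in> P" using P by blast
    have Ps: "P \<subseteq> topspace X" using P by (simp add: openin_subset)
    have "P \<noteq> {x}" using perfect P x Ps by (auto simp: isolated_point_of_def)
    then obtain y where y: "y \<in> P" "y \<noteq> x" using x by blast
    then obtain n where "x \<in> c n" "y \<notin> c n" using sep x Ps by blast
    then have "\<exists>Q. Q \<in> range c \<and> P \<inter> Q \<noteq> {} \<and> P - Q \<noteq> {}" using x y by blast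
    from someI_ex[OF this] show ?thesis unfolding splitter_def if_not_P[OF False] .
  qed
  have clop_step: "openin X (P \<inter> Q) \<and> closedin X (P \<inter> Q) \<and> openin X (P - Q) \<and> closedin X (P - Q)"
    if "openin X P" "closedin X P" "Q \<in> range c" for P Q
    using that clop by auto
  have cell: "openin X (cell X c y n) \<and> closedin X (cell X c y n) \<and> cell X c y n \<noteq> {}" for y n
  proof (induction n)
    case 0
    then show ?case using ne by simp
  next
    case (Suc n)
    then show ?case
      using split[of "cell X c y n" "c n"] clop_step[of "cell X c y n" "?sp (cell X c y n) (c n)"]
      by (simp add: Let_def)
  qed
  have cell_at: "openin X (cell_at X c x n) \<and> closedin X (cell_at X c x n) \<and> x \<in> cell_at X c x n"
    if "x \<in> topspace X" for x n
  proof (induction n)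
    case 0
    then show ?case using that by simp
  next
    case (Suc n)
    then show ?case
      using split[of "cell_at X c x n" "c n"]
        clop_step[of "cell_at X c x n" "?sp (cell_at X c x n) (c n)"]
      by (auto simp: Let_def)
  qed
  define h where "h x n \<longleftrightarrow> x \<in> ?sp (cell_at X c x n) (c n)" for x n
  have cell_h: "cell X c (h x) n = cell_at X c x n" for x n
    by (induction n) (simp_all add: h_def Let_def)
  have cell_mem: "cell_at X c x n = cell X c y n" if "x \<in> cell X c y n" for x y n
    using that
  proof (induction n)
    case 0
    then show ?case by simp
  next
    case (Suc n)
    then show ?case by (auto simp: Let_def split: if_splits)
  qed
  have h_eq: "h x n = y n" if "x \<in> cell X c y (Suc n)" for x y n
  proof -
    have "cell_at X c x n = cell X c y n" 
      using that by (intro cell_mem) (auto simp: Let_def split: if_splits)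
    then show ?thesis using that by (auto simp: h_def Let_def split: if_splits)
  qed
  have "homeomorphic_map X cantor_space h"
  proof (rule continuous_imp_homeomorphic_map)
    show "compact_space X" by (rule comp)
    show "Hausdorff_space (cantor_space)"
      by (simp add: cantor_space_def Hausdorff_space_product_topology)
    have "continuous_map X (discrete_topology UNIV) (\<lambda>x. h x n)" for n
    proof -
      have "openin X {x \<in> topspace X. h x n = b}" for b
      proof (subst openin_subopen, intro ballI)
        fix x assume x: "x \<in> {x \<in> topspace X. h x n = b}"
        have "cell_at X c x (Suc n) \<subseteq> {x \<in> topspace X. h x n = b}"
        proof
          fix z assume z: "z \<in> cell_at X c x (Suc n)"
          then have "h z n = h x n" using h_eq[of z "h x" n] by (simp only: cell_h)
          then show "z \<in> {x \<in> topspace X. h x n = b}"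
            using x z cell_at[of x "Suc n"] openin_subset by fastforce
        qed
        then show "\<exists>T. openin X T \<and> x \<in> T \<and> T \<subseteq> {x \<in> topspace X. h x n = b}"
          using cell_at[of x "Suc n"] x by blast
      qed
      then have "openin X (\<Union>b\<in>U. {x \<in> topspace X. h x n = b})" for U by blast
      moreover have "(\<Union>b\<in>U. {x \<in> topspace X. h x n = b}) = {x \<in> topspace X. h x n \<in> U}" for U
        by blast
      ultimately show ?thesis by (simp add: continuous_map_def)
    qed
    then show "continuous_map X cantor_space h"
      by (simp add: cantor_space_def continuous_map_componentwise_UNIV)
    show "h ` topspace X = topspace cantor_space"
    proof
      show "h ` topspace X \<subseteq> topspace cantor_space" by (auto simp: cantor_space_def)
      show "topspace cantor_space \<subseteq> h ` topspace X"
      proof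
        fix y :: "nat \<Rightarrow> bool"
        have "decseq (cell X c y)" by (rule decseq_SucI) (auto simp: Let_def)
        then have "(\<Inter>n. cell X c y n) \<noteq> {}" using cell comp by (intro compact_space_imp_nest) auto
        then obtain x where x: "\<And>n. x \<in> cell X c y n" by blast
        have "h x = y"
        proof
          show "h x n = y n" for n by (rule h_eq) (rule x)
        qed
moreover have "x \<in> topspace X" using x[of 0] by simp
        ultimately show "y \<in> h ` topspace X" by blast
      qed
    qed
    show "inj_on h (topspace X)"
    proof (rule inj_onI, rule ccontr)
      fix x y assume xy: "x \<in> topspace X" "y \<in> topspace X" "h x = h y" "x \<noteq> y"
      then obtain n where n: "x \<in> c n" "y \<notin> c n" using sep by blast
      let ?P = "cell_at X c x n"
      have "?P = cell_at X c y n" using xy(3) by (metis cell_h)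
      then have "x \<in> ?P" "y \<in> ?P" using cell_at[of x n] cell_at[of y n] xy by simp_all
      then have "?sp ?P (c n) = c n" using n by (auto simp: splitter_def)
      then have "h x n \<noteq> h y n" using n \<open>?P = cell_at X c y n\<close> by (simp add: h_def)
      then show False using xy(3) by simp
    qed
  qed
  then show ?thesis by (rule homeomorphic_map_imp_homeomorphic_space)
qed

text \<open>For each \<open>n\<close>, finitely many basic sets inside balls of radius \<open>1 / (n + 1)\<close> cover the space. Of these,
one that contains \<open>x\<close> omits \<open>y\<close> as soon as its diameter is below the distance of the two points.\<close>

lemma countable_separating_subfamily:
  assumes comp: "compact_space X" and met: "metrizable_space X" and ne: "topspace X \<noteq> {}"
    and base: "\<And>U x. openin X U \<Longrightarrow> x \<in> U \<Longrightarrow> \<exists>V\<in>\<V>. x \<in> V \<and> V \<subseteq> U"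
    and op: "\<And>V. V \<in> \<V> \<Longrightarrow> openin X V"
  obtains c :: "nat \<Rightarrow> 'c set" where "range c \<subseteq> \<V>"
    "\<And>x y. x \<in> topspace X \<Longrightarrow> y \<in> topspace X \<Longrightarrow> x \<noteq> y \<Longrightarrow> \<exists>n. x \<in> c n \<and> y \<notin> c n"
proof -
  obtain M d where Md: "Metric_space M d" and X: "X = Metric_space.mtopology M d"
    using met by (auto simp: metrizable_space_def)
  interpret Metric_space M d by (rule Md)
  have M: "topspace X = M" by (simp add: X)
  let ?small = "\<lambda>n::nat. {V \<in> \<V>. \<exists>x\<in>M. V \<subseteq> mball x (inverse (Suc n))}"
  have "\<exists>\<F>. finite \<F> \<and> \<F> \<subseteq> ?small n \<and> M \<subseteq> \<Union>\<F>" for n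
  proof -
    have "M \<subseteq> \<Union>(?small n)"
    proof
      fix x assume x: "x \<in> M"
      then have "openin X (mball x (inverse (Suc n)))" "x \<in> mball x (inverse (Suc n))"
        by (simp_all add: X)
      then obtain V where "V \<in> \<V>" "x \<in> V" "V \<subseteq> mball x (inverse (Suc n))" using base by blast
      then show "x \<in> \<Union>(?small n)" using x by blast
    qed
    then show ?thesis
      using comp[unfolded compact_space_alt, rule_format, of "?small n"] op M by auto
  qed
  then have "\<forall>n. \<exists>\<F>. finite \<F> \<and> \<F> \<subseteq> ?small n \<and> M \<subseteq> \<Union>\<F>" by blast
  from choice[OF this]
  obtain \<F> where "\<forall>n. finite (\<F> n) \<and> \<F> n \<subseteq> ?small n \<and> M \<subseteq> \<Union>(\<F> n)" ..
  then have \<F>: "\<And>n. finite (\<F> n)" "\<And>n. \<F> n \<subseteq> ?small n" "\<And>n. M \<subseteq> \<Union>(\<F> n)"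
    by blast+
  let ?C = "\<Union>n. \<F> n"
  have "countable ?C" using \<F>(1) by (simp add: countable_finite)
  moreover have "?C \<noteq> {}" using \<F>(3) ne M by blast
  ultimately have rng: "range (from_nat_into ?C) = ?C" by (simp add: range_from_nat_into)
  show ?thesis
  proof (rule that)
    show "range (from_nat_into ?C) \<subseteq> \<V>" unfolding rng using \<F>(2) by blast
    fix x y assume xy: "x \<in> topspace X" "y \<in> topspace X" "x \<noteq> y"
    then have "d x y / 2 > 0" using M by simp
    then obtain n where n: "inverse (real (Suc n)) < d x y / 2" using reals_Archimedean by blast
    obtain V where V: "V \<in> \<F> n" "x \<in> V" using \<F>(3)[of n] xy M by blast
    then obtain z where z: "z \<in> M" "V \<subseteq> mball z (inverse (Suc n))" using \<F>(2)[of n] by blast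
    have "y \<notin> V"
    proof
      assume "y \<in> V"
      then have "d z x < inverse (Suc n)" "d z y < inverse (Suc n)" using z V by auto
      moreover have "d x y \<le> d z x + d z y" using xy M z triangle'' by simp
      ultimately show False using n by linarith
    qed
    moreover have "V \<in> range (from_nat_into ?C)" unfolding rng using V by blast
    ultimately show "\<exists>n. x \<in> from_nat_into ?C n \<and> y \<notin> from_nat_into ?C n" using V by blast
  qed
qed

section \<open>The space of ends of an infinitely-ended group\<close>

theorem theorem1p14:
  fixes G :: "('a, 'b) monoid_scheme"
  assumes "group G" and "infinitely_ended G"
  shows "(\<nexists>x. isolated_point_of (ends_space G) x) \<and>
    (metrizable_space (ends_space G) \<longrightarrow> ends_space G homeomorphic_space cantor_space)"
proof (intro conjI impI)
  interpret group G by (rule assms(1))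
  show perfect: "\<nexists>x. isolated_point_of (ends_space G) x"
    using isolated_end_gives_atom infinitely_ended_no_atom[OF assms(2)] by blast
  assume met: "metrizable_space (ends_space G)"
  have "ends_of G (carrier G) \<noteq> {}"
    using ends_of_nonempty left_commensurated_carrier infinitely_ended_infinite_carrier[OF assms(2)]
    by blast
  then have ne: "topspace (ends_space G) \<noteq> {}"
    using openin_subset[OF openin_ends_of[OF left_commensurated_carrier]] by blast
  let ?\<V> = "ends_of G ` Collect (left_commensurated G)"
  obtain c :: "nat \<Rightarrow> 'a set set set set" where c: "range c \<subseteq> ?\<V>"
    and sep: "\<And>x y. x \<in> topspace (ends_space G) \<Longrightarrow> y \<in> topspace (ends_space G) \<Longrightarrow> x \<noteq> y \<Longrightarrow>
      \<exists>n. x \<in> c n \<and> y \<notin> c n"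
  proof (rule countable_separating_subfamily[OF compact_ends_space met ne, of ?\<V>])
    show "\<exists>V\<in>?\<V>. x \<in> V \<and> V \<subseteq> W" if "openin (ends_space G) W" "x \<in> W" for W x
      using ends_of_basis[OF that] by blast
    show "openin (ends_space G) V" if "V \<in> ?\<V>" for V using that openin_ends_of by blast
  qed (use that in blast)
  have "openin (ends_space G) (c n) \<and> closedin (ends_space G) (c n)" for n
    using c openin_ends_of closedin_ends_of by (metis image_iff mem_Collect_eq rangeI subsetD)
  then show "ends_space G homeomorphic_space cantor_space"
    using homeomorphic_cantor_space[OF compact_ends_space ne perfect _ _ sep] by blast
qed

end
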